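(* Let $D\in\mathbb{R}^{m\times n}$, $\xi>0$ and suppose that $\delta>0$. Let $\{X_k,Z_k,S_k,Y_k,\theta_k\}_{k\in\mathbb{Z}_+}$ be the sequence produced by Algorithm NSA (described in the context) with initial point $Z_0,Y_0\in\mathbb{R}^{m\times n}$ and penalty parameters $0<\rho_0\le\rho_1\le\rho_2\le\cdots$. (i) If $\{\rho_k\}$ is chosen such that $\sum_{k\in\mathbb{Z}_+}\frac{1}{\rho_k}=\infty$, then there exist $X^*,S^*\in\mathbb{R}^{m\times n}$ such that $\lim_{k}Z_k=\lim_{k}X_k=X^*$, $\lim_{k}S_k=S^*$, and $(X^*,S^* )$ is an optimal solution of $$\min_{X,S\in\mathbb{R}^{m\times n}}\{\|X\|_*+\xi\|S\|_1:\ \|X+S-D\|_F\le\delta\}.$$ (ii) Suppose $\{\rho_k\}$ is chosen such that $\sum_{k\in\mathbb{Z}_+}\frac{1}{\rho_k^2}=\infty$, and let $X^*=\lim_k X_k$, $S^*=\lim_k S_k$ be the limits in (i). If $\|D-X^*\|_F\ne\delta$, then there exist $\theta^*\ge 0$ and $Y^*\in\mathbb{R}^{m\times n}$ such that $\lim_k\theta_k=\theta^*$, $\lim_k Y_k=Y^*$, and $(X^*,X^*,S^*,Y^*,\theta^* )$ is a saddle point of the Lagrangian function $$\mathcal{L}(X,Z,S;Y,\theta)=\|X\|_*+\xi\|S\|_1+\langle Y,X-Z\rangle+\frac{\theta}{2}\left(\|Z+S-D\|_F^2-\delta^2\right).$$ Otherwise, if $\|D-X^*\|_F=\delta$, then there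 exists a limit point $(Y^*,\theta^* )$ of the sequence $\{Y_k,\theta_k\}_{k\in\mathbb{Z}_+}$ such that $(Y^*,\theta^* )\in\operatorname{argmax}_{Y,\theta}\{\mathcal{L}(X^*,X^*,S^*;Y,\theta):\ \theta\ge 0\}$.
   Context: $\|X\|_*$ is the nuclear norm (sum of singular values), $\|S\|_1=\sum_{i,j}|S_{ij}|$, $\|\cdot\|_F$ is the Frobenius norm, $\langle\cdot,\cdot\rangle$ is the trace inner product on $\mathbb{R}^{m\times n}$, and $\mathbb{Z}_+$ is the set of positive integers. Algorithm NSA$(Z_0,Y_0)$: given $Z_0,Y_0\in\mathbb{R}^{m\times n}$ and $\rho_0>0$, for $k=0,1,2,\dots$: 1. $X_{k+1}=\operatorname{argmin}_X\{\|X\|_*+\langle Y_k,X-Z_k\rangle+\frac{\rho_k}{2}\|X-Z_k\|_F^2\}$; 2. $\hat Y_{k+1}=Y_k+\rho_k(X_{k+1}-Z_k)$; 3. $(Z_{k+1},S_{k+1})=\operatorname{argmin}_{Z,S}\{\xi\|S\|_1+\langle -Y_k,Z-X_{k+1}\rangle+\frac{\rho_k}{2}\|Z-X_{k+1}\|_F^2:\ \|Z+S-D\|_F^2\le\delta^2\}$; 4. $\theta_k\ge0$ is an optimal Lagrangian dual variable for the constraint $\frac12\|Z+S-D\|_F^2\le\frac{\delta^2}{2}$ in the problem of step 3; 5. $Y_{k+1}=Y_k+\rho_k(X_{k+1}-Z_{k+1})$; 6. choose $\rho_{k+1}\ge\rho_k$. A saddle point $(X^*,Z^*,S^*,Y^*,\theta^*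 )$ of $\mathcal{L}$ (with $\theta^*\ge0$) means $\mathcal{L}(X^*,Z^*,S^*;Y,\theta)\le\mathcal{L}(X^*,Z^*,S^*;Y^*,\theta^* )\le\mathcal{L}(X,Z,S;Y^*,\theta^* )$ for all $X,Z,S,Y\in\mathbb{R}^{m\times n}$ and all $\theta\ge0$. *)

theory Defs
  imports "HOL-Analysis.Analysis"
begin

text \<open>
  Real \<open>m \<times> n\<close> matrices are elements of the type \<open>real^'n^'m\<close>.  On this type the library's
  \<^term>\<open>norm\<close> is the Frobenius norm and its inner product is the trace inner product:
\<close>

lemma norm_eq_Frobenius:
  fixes A :: "real^'n^'m"
  shows "norm A = sqrt (\<Sum>i\<in>UNIV. \<Sum>j\<in>UNIV. (A $ i $ j)\<^sup>2)"
  by (simp add: norm_vec_def L2_set_def sum_nonneg)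

lemma inner_eq_trace:
  fixes A B :: "real^'n^'m"
  shows "A \<bullet> B = trace (transpose A ** B)"
proof -
  have "A \<bullet> B = (\<Sum>i\<in>UNIV. \<Sum>j\<in>UNIV. A $ i $ j * B $ i $ j)"
    by (simp add: inner_vec_def)
  also have "\<dots> = (\<Sum>j\<in>UNIV. \<Sum>i\<in>UNIV. A $ i $ j * B $ i $ j)"
    by (rule sum.swap)
  finally show ?thesis
    by (simp add: trace_def transpose_def matrix_matrix_mult_def)
qed

text \<open>
  The singular values of \<open>A\<close> are the numbers \<open>s \<ge> 0\<close> such that \<open>s\<^sup>2\<close> is an eigenvalue of the
  symmetric matrix \<open>A\<^sup>T A\<close>; the multiplicity of \<open>s\<close> is the dimension of that eigenspace.
  Conventions in the literature differ only in the multiplicity of the singular value \<open>0\<close>, which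
  does not affect the nuclear norm.
\<close>

definition right_singular_space :: "real^'n^'m \<Rightarrow> real \<Rightarrow> (real^'n) set" where
  "right_singular_space A s = {v. (transpose A ** A) *v v = s\<^sup>2 *\<^sub>R v}"

definition singular_values :: "real^'n^'m \<Rightarrow> real set" where
  "singular_values A = {s. 0 \<le> s \<and> (\<exists>v\<in>right_singular_space A s. v \<noteq> 0)}"

definition nuclear_norm :: "real^'n^'m \<Rightarrow> real" where
  "nuclear_norm A = (\<Sum>s\<in>singular_values A. real (dim (right_singular_space A s)) * s)"

text \<open>The index set of the sum above is finite, so \<^const>\<open>sum\<close> is meaningful.\<close>

lemma finite_singular_values:
  fixes A :: "real^'n^'m"
  shows "finite (singular_values A)"
proof -
  define M where "M = transpose A ** A"
  have sym: "(M *v u) \<bullet> w = u \<bullet> (M *v w)" for u w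
  proof -
    have "transpose M = M"
      by (simp add: M_def matrix_transpose_mul)
    then show ?thesis
      by (metis dot_lmul_matrix transpose_matrix_vector)
  qed
  have "\<forall>s\<in>singular_values A. \<exists>v. v \<noteq> 0 \<and> M *v v = s\<^sup>2 *\<^sub>R v"
    by (auto simp: singular_values_def right_singular_space_def M_def)
  then obtain v where v: "\<And>s. s \<in> singular_values A \<Longrightarrow> v s \<noteq> 0 \<and> M *v v s = s\<^sup>2 *\<^sub>R v s"
    by metis
  have orth: "v s \<bullet> v t = 0" if "s \<in> singular_values A" "t \<in> singular_values A" "s \<noteq> t" for s t
  proof -
    have "s\<^sup>2 * (v s \<bullet> v t) = t\<^sup>2 * (v s \<bullet> v t)"
      using sym[of "v s" "v t"] v that by simp
    moreover have "s\<^sup>2 \<noteq> t\<^sup>2"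
      using that by (simp add: singular_values_def)
    ultimately show ?thesis
      by simp
  qed
  have inj: "inj_on v (singular_values A)"
    by (rule inj_onI) (metis orth v inner_eq_zero_iff)
  have "pairwise orthogonal (v ` singular_values A)"
    using orth by (auto simp: pairwise_def orthogonal_def)
  then have "finite (v ` singular_values A)"
    by (rule pairwise_orthogonal_imp_finite)
  then show ?thesis
    using inj by (rule finite_imageD)
qed

definition entry_l1_norm :: "real^'n^'m \<Rightarrow> real" where
  "entry_l1_norm S = (\<Sum>i\<in>UNIV. \<Sum>j\<in>UNIV. \<bar>S $ i $ j\<bar>)"

text \<open>
  Lagrangian duality for the problem of minimising \<open>f x\<close> subject to \<open>g x \<le> 0\<close>.  The dual function
  takes values in the extended reals, since the infimum may be \<open>-\<infinity>\<close> in general.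
\<close>

definition lagrange_dual_function :: "('a \<Rightarrow> real) \<Rightarrow> ('a \<Rightarrow> real) \<Rightarrow> real \<Rightarrow> ereal" where
  "lagrange_dual_function f g t = (INF x. ereal (f x + t * g x))"

definition optimal_dual_variable :: "('a \<Rightarrow> real) \<Rightarrow> ('a \<Rightarrow> real) \<Rightarrow> real \<Rightarrow> bool" where
  "optimal_dual_variable f g t \<longleftrightarrow> is_arg_max (lagrange_dual_function f g) (\<lambda>t. 0 \<le> t) t"

definition NSA_X_objective ::
  "real^'n^'m \<Rightarrow> real^'n^'m \<Rightarrow> real \<Rightarrow> real^'n^'m \<Rightarrow> real" where
  "NSA_X_objective Zk Yk r X =
     nuclear_norm X + Yk \<bullet> (X - Zk) + r / 2 * (norm (X - Zk))\<^sup>2"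

definition NSA_ZS_objective ::
  "real \<Rightarrow> real^'n^'m \<Rightarrow> real^'n^'m \<Rightarrow> real \<Rightarrow> (real^'n^'m) \<times> (real^'n^'m) \<Rightarrow> real" where
  "NSA_ZS_objective \<xi> X Yk r = (\<lambda>(Z, S).
     \<xi> * entry_l1_norm S + (- Yk) \<bullet> (Z - X) + r / 2 * (norm (Z - X))\<^sup>2)"

text \<open>
  The sequences \<open>X, Yh, Z, S, Y, \<theta>, \<rho>\<close> form a run of the algorithm.  The initial point is
  \<open>(Z 0, Y 0)\<close>; the entries \<open>X 0\<close>, \<open>Yh 0\<close> and \<open>S 0\<close> are not produced by the algorithm and are
  left unconstrained.
\<close>

definition NSA_run ::
  "real^'n^'m \<Rightarrow> real \<Rightarrow> real \<Rightarrow>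
   (nat \<Rightarrow> real^'n^'m) \<Rightarrow> (nat \<Rightarrow> real^'n^'m) \<Rightarrow> (nat \<Rightarrow> real^'n^'m) \<Rightarrow> (nat \<Rightarrow> real^'n^'m) \<Rightarrow>
   (nat \<Rightarrow> real^'n^'m) \<Rightarrow> (nat \<Rightarrow> real) \<Rightarrow> (nat \<Rightarrow> real) \<Rightarrow> bool" where
  "NSA_run D \<xi> \<delta> X Yh Z S Y \<theta> \<rho> \<longleftrightarrow>
     0 < \<rho> 0 \<and>
     (\<forall>k.
        is_arg_min (NSA_X_objective (Z k) (Y k) (\<rho> k)) (\<lambda>_. True) (X (Suc k)) \<and>
        Yh (Suc k) = Y k + \<rho> k *\<^sub>R (X (Suc k) - Z k) \<and>
        is_arg_min (NSA_ZS_objective \<xi> (X (Suc k)) (Y k) (\<rho> k))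
          (\<lambda>(Z', S'). (norm (Z' + S' - D))\<^sup>2 \<le> \<delta>\<^sup>2) (Z (Suc k), S (Suc k)) \<and>
        optimal_dual_variable (NSA_ZS_objective \<xi> (X (Suc k)) (Y k) (\<rho> k))
          (\<lambda>(Z', S'). 1 / 2 * (norm (Z' + S' - D))\<^sup>2 - \<delta>\<^sup>2 / 2) (\<theta> k) \<and>
        Y (Suc k) = Y k + \<rho> k *\<^sub>R (X (Suc k) - Z (Suc k)) \<and>
        \<rho> k \<le> \<rho> (Suc k))"

definition SPCP_lagrangian ::
  "real^'n^'m \<Rightarrow> real \<Rightarrow> real \<Rightarrow>
   real^'n^'m \<Rightarrow> real^'n^'m \<Rightarrow> real^'n^'m \<Rightarrow> real^'n^'m \<Rightarrow> real \<Rightarrow> real" where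
  "SPCP_lagrangian D \<xi> \<delta> X Z S Y \<theta> =
     nuclear_norm X + \<xi> * entry_l1_norm S + Y \<bullet> (X - Z)
       + \<theta> / 2 * ((norm (Z + S - D))\<^sup>2 - \<delta>\<^sup>2)"

definition SPCP_saddle_point ::
  "real^'n^'m \<Rightarrow> real \<Rightarrow> real \<Rightarrow>
   real^'n^'m \<Rightarrow> real^'n^'m \<Rightarrow> real^'n^'m \<Rightarrow> real^'n^'m \<Rightarrow> real \<Rightarrow> bool" where
  "SPCP_saddle_point D \<xi> \<delta> Xs Zs Ss Ys \<theta>s \<longleftrightarrow>
     0 \<le> \<theta>s \<and>
     (\<forall>X Z S Y. \<forall>\<theta>\<ge>0.
        SPCP_lagrangian D \<xi> \<delta> Xs Zs Ss Y \<theta> \<le> SPCP_lagrangian D \<xi> \<delta> Xs Zs Ss Ys \<theta>s \<and>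
        SPCP_lagrangian D \<xi> \<delta> Xs Zs Ss Ys \<theta>s \<le> SPCP_lagrangian D \<xi> \<delta> X Z S Ys \<theta>s)"

definition SPCP_optimal ::
  "real^'n^'m \<Rightarrow> real \<Rightarrow> real \<Rightarrow> real^'n^'m \<Rightarrow> real^'n^'m \<Rightarrow> bool" where
  "SPCP_optimal D \<xi> \<delta> Xs Ss \<longleftrightarrow>
     is_arg_min (\<lambda>(X, S). nuclear_norm X + \<xi> * entry_l1_norm S)
       (\<lambda>(X, S). norm (X + S - D) \<le> \<delta>) (Xs, Ss)"

end

theory Submission
  imports Defs
begin

text \<open>
  Write \<open>f\<close> for the nuclear norm, \<open>g\<close> for \<open>\<xi>\<close> times the entrywise norm, and let \<open>h Z\<close> be the least
  value of \<open>g S\<close> subject to \<open>|Z + S - D| \<le> \<delta>\<close>.  The problem is to minimise \<open>f + h\<close>, and the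
  algorithm is the alternating direction method for the splitting \<open>f X + h Z\<close>, \<open>X = Z\<close>.

  The optimality conditions of the two steps say that the negative of the intermediate multiplier
  \<open>Y k + \<rho> k (X (k + 1) - Z k)\<close> is a subgradient of \<open>f\<close> at \<open>X (k + 1)\<close> (\<open>X_step_subgradient\<close>)
  and that \<open>Y (k + 1)\<close> is a subgradient of \<open>h\<close> at \<open>Z (k + 1)\<close> (\<open>ZS_step_kkt\<close>, \<open>kkt_supports\<close>).
  The second one rests on strong duality for a single convex constraint with a Slater point
  (\<open>slater_multiplier\<close>); it also gives \<open>Y (k + 1) = \<theta> k (Z (k + 1) + S (k + 1) - D)\<close>, and it
  makes \<open>- Y (k + 1)\<close> a subgradient of \<open>g\<close>, so the multipliers are bounded.  For \<open>f\<close>, only convexity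
  and nonnegativity are required; convexity of the nuclear norm comes from its duality with
  the operator norm, which is read off an orthonormal basis of singular vectors
  (\<open>convex_nuclear_norm\<close>).

  Let \<open>x\<close> be optimal with multiplier \<open>y\<close>.  By monotonicity of subgradients the energy
  \<open>|Z k - x|\<^sup>2 + |Y k - y|\<^sup>2 / (\<rho> k)\<^sup>2\<close> decreases, and its decrease dominates \<open>|Z (k + 1) - Z k|\<^sup>2\<close>,
  \<open>|X (k + 1) - Z (k + 1)|\<^sup>2\<close> and \<open>1 / \<rho> k\<close> times a nonnegative gap that bounds the suboptimality
  of the iterate (\<open>energy_descent\<close>, \<open>objective_le_gap\<close>).  When the sum of \<open>1 / \<rho> k\<close> diverges, the
  gap vanishes along a subsequence, whose limit points are optimal; measured from such a limit point, with a
  suitable multiplier, the energy tends to zero along a subsequence and hence altogether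
  (\<open>converges_to_optimum\<close>).  The component \<open>S\<close> converges because the minimiser defining \<open>h\<close> is unique
  (\<open>least_g_unique\<close>).

  For the multipliers, let \<open>x\<close> and \<open>s\<close> be the limits.  If \<open>|D - x| < \<delta>\<close> the constraint becomes
  inactive and the multipliers vanish eventually; if \<open>|D - x| > \<delta>\<close> then \<open>s \<noteq> 0\<close>, and pairing the
  optimality condition for \<open>g\<close> with \<open>S (k + 1)\<close> expresses \<open>\<theta> k\<close> as a convergent quotient
  (\<open>multipliers_converge\<close>).  In both cases the limit is the multiplier of \<open>(x, s)\<close>, which forms a
  saddle point with it (\<open>kkt_saddle_point\<close>).  If \<open>|D - x| = \<delta>\<close>, then \<open>s = 0\<close>, and the Lagrangian at
  \<open>(x, x, s)\<close> is constant in the multipliers, so that every limit point with \<open>\<theta> \<ge> 0\<close> maximises it;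
  limit points exist by boundedness (\<open>multipliers_limit_point\<close>).
\<close>

section \<open>Singular vectors and convexity of the nuclear norm\<close>

text \<open>
  The slope at \<open>0\<close> of a quadratic that vanishes there and stays nonnegative just to the right of it.
  This is the form in which first-order optimality conditions are extracted below.
\<close>
lemma nonneg_slope_at_zero:
  fixes a b :: real
  assumes "\<And>t. 0 < t \<Longrightarrow> t \<le> 1 \<Longrightarrow> 0 \<le> t * a + t\<^sup>2 * b"
  shows "0 \<le> a"
proof (rule ccontr)
  assume "\<not> 0 \<le> a"
  define c where "c = \<bar>b\<bar> + 1"
  define t where "t = min 1 (- a / (2 * c))"
  have "0 < c" "b \<le> c"
    by (auto simp: c_def)
  then have t: "0 < t" "t \<le> 1"
    using \<open>\<not> 0 \<le> a\<close> by (auto simp: t_def divide_neg_pos)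
  have "t \<le> - a / (2 * c)"
    by (simp add: t_def)
  then have tc: "t * c \<le> - a / 2"
    using \<open>0 < c\<close> by (simp add: field_simps)
  have "0 \<le> t * (a + t * b)"
    using assms[OF t(1,2)] by (simp add: power2_eq_square algebra_simps)
  then have "0 \<le> a + t * b"
    using t(1) by (simp add: zero_le_mult_iff)
  also have "t * b \<le> t * c"
    using t(1) \<open>b \<le> c\<close> by (intro mult_left_mono) auto
  finally show False
    using tc \<open>\<not> 0 \<le> a\<close> by simp
qed

text \<open>
  A maximiser \<open>x\<close> of the Rayleigh quotient over the unit sphere of the subspace is an eigenvector:
  with \<open>l\<close> the maximum, the quadratic form of \<open>l - L\<close> is nonnegative and vanishes at \<open>x\<close>.
\<close>
lemma eigenvector_in_invariant_subspace:
  fixes L :: "'a::euclidean_space \<Rightarrow> 'a"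
  assumes lin: "linear L" and sym: "\<And>x y. L x \<bullet> y = x \<bullet> L y"
    and T: "subspace T" and inv: "\<And>x. x \<in> T \<Longrightarrow> L x \<in> T" and "T \<noteq> {0}"
  obtains x l where "x \<in> T" "norm x = 1" "L x = l *\<^sub>R x"
proof -
  interpret linear L by (rule lin)
  have "0 \<in> T"
    using T by (rule subspace_0)
  with \<open>T \<noteq> {0}\<close> obtain z where z: "z \<in> T" "z \<noteq> 0"
    by blast
  define K where "K = T \<inter> sphere 0 1"
  have "z /\<^sub>R norm z \<in> K"
    using z T by (simp add: K_def subspace_scale)
  moreover have "compact K"
    unfolding K_def using T by (intro closed_Int_compact closed_subspace compact_sphere)
  moreover have "continuous_on K (\<lambda>x. L x \<bullet> x)"
    using lin by (intro continuous_intros linear_continuous_on linear_conv_bounded_linear[THEN iffD1])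
  ultimately obtain x where x: "x \<in> K" and xmax: "\<And>y. y \<in> K \<Longrightarrow> L y \<bullet> y \<le> L x \<bullet> x"
    using continuous_attains_sup[of K "\<lambda>x. L x \<bullet> x"] by blast
  define l where "l = L x \<bullet> x"
  have xT: "x \<in> T" and x1: "x \<bullet> x = 1"
    using x by (auto simp: K_def norm_eq_1)
  have quad: "0 \<le> l * (y \<bullet> y) - L y \<bullet> y" if "y \<in> T" for y
  proof (cases "y = 0")
    case False
    then have "y /\<^sub>R norm y \<in> K"
      using that T by (simp add: K_def subspace_scale)
    from xmax[OF this] have "L y \<bullet> y / (norm y)\<^sup>2 \<le> l"
      by (simp add: l_def scale power2_eq_square divide_inverse mult_ac)
    then show ?thesis
      using False by (simp add: power2_norm_eq_inner pos_divide_le_eq)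
  qed simp
  define w where "w = l *\<^sub>R x - L x"
  have wT: "w \<in> T"
    unfolding w_def using T xT inv by (intro subspace_diff subspace_scale)
  \<comment> \<open>The nonnegative form \<open>quad\<close> vanishes at \<open>x\<close>, so it is stationary there, also in the
    direction \<open>-w\<close>.\<close>
  have "0 \<le> - 2 * (w \<bullet> w)"
  proof (rule nonneg_slope_at_zero)
    fix t :: real
    have "x - t *\<^sub>R w \<in> T"
      using T xT wT by (intro subspace_diff subspace_scale)
    note quad[OF this]
    moreover have "l * ((x - t *\<^sub>R w) \<bullet> (x - t *\<^sub>R w)) - L (x - t *\<^sub>R w) \<bullet> (x - t *\<^sub>R w)
        = t * (- 2 * (l * (x \<bullet> w) - L x \<bullet> w)) + t\<^sup>2 * (l * (w \<bullet> w) - L w \<bullet> w)"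
      using x1 sym[of w x] inner_commute[of w x] inner_commute[of w "L x"]
      by (simp add: diff scale inner_diff_left inner_diff_right power2_eq_square
          l_def[symmetric]) (simp add: algebra_simps)
    moreover have "w \<bullet> w = l * (x \<bullet> w) - L x \<bullet> w"
      by (subst (1) w_def) (simp add: inner_diff_left)
    ultimately show "0 \<le> t * (- 2 * (w \<bullet> w)) + t\<^sup>2 * (l * (w \<bullet> w) - L w \<bullet> w)"
      by simp
  qed
  then have "w \<bullet> w = 0"
    using inner_ge_zero[of w] by linarith
  then have "L x = l *\<^sub>R x"
    by (simp add: w_def)
  with that xT x show ?thesis
    by (auto simp: K_def)
qed

text \<open>
  The orthogonal complement of a set of eigenvectors is invariant under a self-adjoint map.  If it
  contained more than \<open>0\<close>, it would contain a further eigenvector, so for an orthonormal set of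
  eigenvectors of greatest size it is trivial.
\<close>
lemma orthonormal_eigenbasis:
  fixes L :: "'a::euclidean_space \<Rightarrow> 'a"
  assumes lin: "linear L" and sym: "\<And>x y. L x \<bullet> y = x \<bullet> L y"
  obtains B where "finite B" "pairwise orthogonal B" "\<And>v. v \<in> B \<Longrightarrow> norm v = 1"
    "\<And>v. v \<in> B \<Longrightarrow> \<exists>l. L v = l *\<^sub>R v" "\<And>x. (\<Sum>v\<in>B. (v \<bullet> x) *\<^sub>R v) = x"
proof -
  define P where "P B \<longleftrightarrow> finite B \<and> pairwise orthogonal B \<and>
    (\<forall>v\<in>B. norm v = 1 \<and> (\<exists>l. L v = l *\<^sub>R v))" for B
  have bound: "card B \<le> DIM('a)" if "P B" for B
    using that unfolding P_def
    by (metis independent_bound norm_zero pairwise_orthogonal_independent zero_neq_one)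
  have "P {}"
    by (simp add: P_def)
  then obtain B where B: "P B" and Bmax: "\<And>C. P C \<Longrightarrow> card C \<le> card B"
    using ex_has_greatest_nat[of P "{}" card "DIM('a) + 1"] bound by (metis le_imp_less_Suc Suc_eq_plus1)
  have fin: "finite B" and ortho: "pairwise orthogonal B"
    and unit: "\<And>v. v \<in> B \<Longrightarrow> norm v = 1" and eig: "\<And>v. v \<in> B \<Longrightarrow> \<exists>l. L v = l *\<^sub>R v"
    using B by (auto simp: P_def)
  define T where "T = {x. \<forall>v\<in>B. v \<bullet> x = 0}"
  have "T = {0}"
  proof (rule ccontr)
    assume "T \<noteq> {0}"
    moreover have "subspace T"
      by (auto simp: T_def subspace_def inner_add_right)
    moreover have "L x \<in> T" if "x \<in> T" for x
    proof -
      have "v \<bullet> L x = 0" if "v \<in> B" for v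
      proof -
        obtain l where "L v = l *\<^sub>R v" using eig[OF \<open>v \<in> B\<close>] by blast
        then show ?thesis
          using \<open>x \<in> T\<close> that by (simp add: T_def sym[symmetric])
      qed
      then show ?thesis by (simp add: T_def)
    qed
    ultimately obtain x l where x: "x \<in> T" "norm x = 1" "L x = l *\<^sub>R x"
      using eigenvector_in_invariant_subspace[OF lin sym] by metis
    have "x \<notin> B"
      using x(1,2) by (auto simp: T_def)
    moreover have "P (insert x B)"
      using fin ortho unit eig x
      by (auto simp: P_def T_def pairwise_insert orthogonal_def inner_commute)
    ultimately show False
      using Bmax[of "insert x B"] fin by simp
  qed
  have "(\<Sum>v\<in>B. (v \<bullet> x) *\<^sub>R v) = x" for x
  proof -
    have "u \<bullet> (\<Sum>v\<in>B. (v \<bullet> x) *\<^sub>R v) = u \<bullet> x" if "u \<in> B" for u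
    proof -
      have "u \<bullet> (\<Sum>v\<in>B. (v \<bullet> x) *\<^sub>R v) = (\<Sum>v\<in>B. if v = u then u \<bullet> x else 0)"
        unfolding inner_sum_right
      proof (rule sum.cong)
        fix v assume "v \<in> B"
        then show "u \<bullet> (v \<bullet> x) *\<^sub>R v = (if v = u then u \<bullet> x else 0)"
          using that ortho unit[of u] by (auto simp: pairwise_def orthogonal_def norm_eq_1)
      qed simp
      then show ?thesis
        using that fin by simp
    qed
    then have "x - (\<Sum>v\<in>B. (v \<bullet> x) *\<^sub>R v) \<in> T"
      by (simp add: T_def inner_diff_right)
    then show ?thesis
      using \<open>T = {0}\<close> by simp
  qed
  with that fin ortho unit eig show ?thesis
    by blast
qed

text \<open>
  In an orthonormal eigenbasis of \<open>A\<^sup>T A\<close> the eigenspace for \<open>s\<^sup>2\<close> is spanned by the basis vectors \<open>v\<close>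
  with \<open>|A v| = s\<close>, so its dimension counts them.  This turns the sum over singular values with
  multiplicity into a sum over one basis.
\<close>
lemma orthonormal_right_singular_vectors:
  fixes A :: "real^'n^'m"
  obtains B where "finite B" "pairwise orthogonal B" "\<And>v. v \<in> B \<Longrightarrow> norm v = 1"
    "\<And>v. v \<in> B \<Longrightarrow> (transpose A ** A) *v v = (norm (A *v v))\<^sup>2 *\<^sub>R v"
    "\<And>x. (\<Sum>v\<in>B. (v \<bullet> x) *\<^sub>R v) = x"
    "nuclear_norm A = (\<Sum>v\<in>B. norm (A *v v))"
proof -
  define M where "M = transpose A ** A"
  have M: "x \<bullet> (M *v y) = (A *v x) \<bullet> (A *v y)" for x y
    unfolding M_def by (simp flip: matrix_vector_mul_assoc)
      (metis dot_lmul_matrix inner_commute transpose_matrix_vector)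
  have sym: "(M *v x) \<bullet> y = x \<bullet> (M *v y)" for x y
    using M[of x y] M[of y x] by (simp add: inner_commute)
  obtain B where B: "finite B" "pairwise orthogonal B" "\<And>v. v \<in> B \<Longrightarrow> norm v = 1"
    and eig: "\<And>v. v \<in> B \<Longrightarrow> \<exists>l. M *v v = l *\<^sub>R v"
    and expand: "\<And>x. (\<Sum>v\<in>B. (v \<bullet> x) *\<^sub>R v) = x"
    using orthonormal_eigenbasis[of "(*v) M", OF matrix_vector_mul_linear sym] by blast
  have eigA: "M *v v = (norm (A *v v))\<^sup>2 *\<^sub>R v" if v: "v \<in> B" for v
  proof -
    obtain l where l: "M *v v = l *\<^sub>R v"
      using eig v by blast
    then have "(norm (A *v v))\<^sup>2 = l"
      using M[of v v] B(3)[OF v] by (simp add: power2_norm_eq_inner norm_eq_1)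
    with l show ?thesis by simp
  qed
  have eq_norm: "s = norm (A *v v)"
    if "v \<in> B" "0 \<le> s" "x \<in> right_singular_space A s" "v \<bullet> x \<noteq> 0" for v s x
  proof -
    have "s\<^sup>2 * (v \<bullet> x) = (norm (A *v v))\<^sup>2 * (v \<bullet> x)"
      using that(3) sym[of v x] eigA[OF that(1)]
      by (auto simp: right_singular_space_def M_def[symmetric])
    with that(4) have "s\<^sup>2 = (norm (A *v v))\<^sup>2"
      by simp
    with that(2) show ?thesis
      by simp
  qed
  have space: "right_singular_space A s = span {v\<in>B. norm (A *v v) = s}" if s: "0 \<le> s" for s
  proof
    show "right_singular_space A s \<subseteq> span {v\<in>B. norm (A *v v) = s}"
    proof
      fix x assume x: "x \<in> right_singular_space A s"
      have "(v \<bullet> x) *\<^sub>R v \<in> span {v\<in>B. norm (A *v v) = s}" if "v \<in> B" for v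
        using eq_norm[OF that s x] that
        by (cases "v \<bullet> x = 0") (auto intro: span_zero span_scale span_base)
      then show "x \<in> span {v\<in>B. norm (A *v v) = s}"
        by (subst expand[of x, symmetric]) (rule span_sum)
    qed
    have "subspace (right_singular_space A s)"
      by (auto simp: right_singular_space_def subspace_def matrix_vector_right_distrib
          scaleR_add_right matrix_vector_mult_scaleR)
    then show "span {v\<in>B. norm (A *v v) = s} \<subseteq> right_singular_space A s"
      using eigA by (intro span_minimal) (auto simp: right_singular_space_def M_def)
  qed
  have nz: "v \<noteq> 0" if "v \<in> B" for v
    using B(3)[OF that] by auto
  have ind: "independent B"
    using B(2) nz by (intro pairwise_orthogonal_independent) auto
  have mult: "dim (right_singular_space A s) = card {v\<in>B. norm (A *v v) = s}" if "0 \<le> s" for s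
    unfolding space[OF that] dim_span
    by (rule dim_eq_card_independent) (rule independent_mono[OF ind], auto)
  have sub: "(\<lambda>v. norm (A *v v)) ` B \<subseteq> singular_values A"
    using eigA nz by (auto simp: singular_values_def right_singular_space_def M_def[symmetric])
  have "nuclear_norm A = (\<Sum>s\<in>singular_values A. \<Sum>v\<in>{v\<in>B. norm (A *v v) = s}. norm (A *v v))"
    unfolding nuclear_norm_def
    by (intro sum.cong refl) (simp add: mult singular_values_def)
  also have "\<dots> = (\<Sum>v\<in>B. norm (A *v v))"
    by (rule sum.group[OF B(1) finite_singular_values sub])
  finally have "nuclear_norm A = (\<Sum>v\<in>B. norm (A *v v))" .
  with that B eigA expand show ?thesis
    unfolding M_def by blast
qed

text \<open>
  A synthesis operator with orthogonal vectors of length at most one is a contraction.  The length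
  zero is allowed because the normalised images \<open>A v / |A v|\<close> vanish on the kernel of \<open>A\<close>.
\<close>
lemma bessel_contraction:
  fixes w :: "'i \<Rightarrow> 'a::real_inner"
  assumes "finite B" and orth: "\<And>u v. u \<in> B \<Longrightarrow> v \<in> B \<Longrightarrow> u \<noteq> v \<Longrightarrow> w u \<bullet> w v = 0"
    and le1: "\<And>v. v \<in> B \<Longrightarrow> norm (w v) \<le> 1"
  shows "(norm (\<Sum>v\<in>B. c v *\<^sub>R w v))\<^sup>2 \<le> (\<Sum>v\<in>B. (c v)\<^sup>2)"
proof -
  have "(norm (\<Sum>v\<in>B. c v *\<^sub>R w v))\<^sup>2 = (\<Sum>u\<in>B. \<Sum>v\<in>B. c u * c v * (w u \<bullet> w v))"
    by (simp add: power2_norm_eq_inner inner_sum_left inner_sum_right sum_distrib_left mult_ac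
        inner_commute)
  also have "\<dots> = (\<Sum>u\<in>B. \<Sum>v\<in>B. if v = u then c u * c u * (w u \<bullet> w u) else 0)"
    using orth by (intro sum.cong refl) auto
  also have "\<dots> = (\<Sum>u\<in>B. (c u)\<^sup>2 * (norm (w u))\<^sup>2)"
    using \<open>finite B\<close> by (simp add: power2_norm_eq_inner[symmetric]) (simp add: power2_eq_square)
  also have "\<dots> \<le> (\<Sum>u\<in>B. (c u)\<^sup>2)"
    using le1 by (intro sum_mono) (simp add: mult_left_le power_le_one)
  finally show ?thesis .
qed

lemma nuclear_norm_nonneg: "0 \<le> nuclear_norm A"
  unfolding nuclear_norm_def singular_values_def by (auto intro: sum_nonneg)

text \<open>
  One half of the duality between nuclear and operator norm: the left-hand side is the trace inner
  product of \<open>A\<close> with the map taking \<open>u\<close> to the sum of \<open>(v \<bullet> u) w v\<close> over \<open>v \<in> C\<close>, which is a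
  contraction by Parseval's identity for \<open>C\<close>.  Expanding each \<open>v\<close> in the singular basis of \<open>A\<close> reduces it to pairings of the vectors \<open>A u\<close> with
  vectors of length at most one.
\<close>
lemma nuclear_norm_ge_pairing:
  fixes A :: "real^'n^'m" and w :: "real^'n \<Rightarrow> real^'m"
  assumes "finite C" and "\<And>x. (\<Sum>v\<in>C. (v \<bullet> x)\<^sup>2) = (norm x)\<^sup>2"
    and orth: "\<And>u v. u \<in> C \<Longrightarrow> v \<in> C \<Longrightarrow> u \<noteq> v \<Longrightarrow> w u \<bullet> w v = 0"
    and le1: "\<And>v. v \<in> C \<Longrightarrow> norm (w v) \<le> 1"
  shows "(\<Sum>v\<in>C. w v \<bullet> (A *v v)) \<le> nuclear_norm A"
proof -
  obtain B where "finite B" "pairwise orthogonal B" and unit: "\<And>v. v \<in> B \<Longrightarrow> norm v = 1"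
    and "\<And>v. v \<in> B \<Longrightarrow> (transpose A ** A) *v v = (norm (A *v v))\<^sup>2 *\<^sub>R v"
    and expand: "\<And>x. (\<Sum>v\<in>B. (v \<bullet> x) *\<^sub>R v) = x"
    and nn: "nuclear_norm A = (\<Sum>v\<in>B. norm (A *v v))"
    using orthonormal_right_singular_vectors[of A] by blast
  have exp: "A *v v = (\<Sum>u\<in>B. (u \<bullet> v) *\<^sub>R (A *v u))" for v
    by (subst expand[of v, symmetric])
      (simp add: linear_sum[OF matrix_vector_mul_linear] linear_cmul[OF matrix_vector_mul_linear])
  have "(\<Sum>v\<in>C. w v \<bullet> (A *v v)) = (\<Sum>v\<in>C. \<Sum>u\<in>B. (u \<bullet> v) * (w v \<bullet> (A *v u)))"
    by (subst exp) (simp add: inner_sum_right)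
  also have "\<dots> = (\<Sum>u\<in>B. (\<Sum>v\<in>C. (v \<bullet> u) *\<^sub>R w v) \<bullet> (A *v u))"
    by (subst sum.swap) (simp add: inner_sum_left inner_commute[where ?'a = "real^'n"])
  also have "\<dots> \<le> (\<Sum>u\<in>B. norm (A *v u))"
  proof (rule sum_mono)
    fix u assume u: "u \<in> B"
    have "(norm (\<Sum>v\<in>C. (v \<bullet> u) *\<^sub>R w v))\<^sup>2 \<le> 1\<^sup>2"
      using bessel_contraction[OF \<open>finite C\<close> orth le1, where c = "\<lambda>v. v \<bullet> u"] assms(2)[of u] unit[OF u]
      by simp
    then have "norm (\<Sum>v\<in>C. (v \<bullet> u) *\<^sub>R w v) \<le> 1"
      by (rule power2_le_imp_le) simp
    then show "(\<Sum>v\<in>C. (v \<bullet> u) *\<^sub>R w v) \<bullet> (A *v u) \<le> norm (A *v u)"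
      by (intro order_trans[OF norm_cauchy_schwarz] mult_left_le_one_le) auto
  qed
  finally show ?thesis
    by (simp add: nn)
qed

text \<open>
  The nuclear norm is a pointwise maximum of linear functionals: the pairings of the previous lemma
  never exceed it, and the choice \<open>w v = A v / |A v|\<close> (the partial isometry of the polar
  decomposition of \<open>A\<close>) attains it.  For \<open>A\<close> a convex combination, that one functional bounds its
  value by the combination of the values at the two end points.
\<close>
lemma convex_nuclear_norm: "convex_on UNIV (nuclear_norm :: real^'n^'m \<Rightarrow> real)"
proof (rule convex_onI)
  fix t :: real and A1 A2 :: "real^'n^'m"
  assume t: "0 < t" "t < 1"
  define A where "A = (1 - t) *\<^sub>R A1 + t *\<^sub>R A2"
  obtain C where C: "finite C" "pairwise orthogonal C" "\<And>v. v \<in> C \<Longrightarrow> norm v = 1"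
    and eig: "\<And>v. v \<in> C \<Longrightarrow> (transpose A ** A) *v v = (norm (A *v v))\<^sup>2 *\<^sub>R v"
    and expand: "\<And>x. (\<Sum>v\<in>C. (v \<bullet> x) *\<^sub>R v) = x"
    and nn: "nuclear_norm A = (\<Sum>v\<in>C. norm (A *v v))"
    using orthonormal_right_singular_vectors[of A] by blast
  define w where "w v = A *v v /\<^sub>R norm (A *v v)" for v
  have parseval: "(\<Sum>v\<in>C. (v \<bullet> x)\<^sup>2) = (norm x)\<^sup>2" for x
  proof -
    have "(norm x)\<^sup>2 = x \<bullet> (\<Sum>v\<in>C. (v \<bullet> x) *\<^sub>R v)"
      by (simp only: expand power2_norm_eq_inner)
    then show ?thesis
      by (simp add: inner_sum_right power2_eq_square inner_commute)
  qed
  have orth: "w u \<bullet> w v = 0" if "u \<in> C" "v \<in> C" "u \<noteq> v" for u v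
  proof -
    have "(A *v u) \<bullet> (A *v v) = u \<bullet> ((transpose A ** A) *v v)"
      by (simp flip: matrix_vector_mul_assoc)
        (metis dot_lmul_matrix inner_commute transpose_matrix_vector)
    also have "\<dots> = 0"
      using eig C(2) that by (simp add: pairwise_def orthogonal_def)
    finally show ?thesis
      by (simp add: w_def)
  qed
  have le1: "norm (w v) \<le> 1" for v
    by (cases "A *v v = 0") (simp_all add: w_def)
  have attained: "w v \<bullet> (A *v v) = norm (A *v v)" for v
    by (cases "A *v v = 0") (simp_all add: w_def dot_square_norm power2_eq_square)
  have "nuclear_norm A = (\<Sum>v\<in>C. w v \<bullet> (A *v v))"
    by (simp add: nn attained)
  also have "\<dots> = (1 - t) * (\<Sum>v\<in>C. w v \<bullet> (A1 *v v)) + t * (\<Sum>v\<in>C. w v \<bullet> (A2 *v v))"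
    unfolding A_def by (simp add: matrix_vector_mult_add_rdistrib scaleR_matrix_vector_assoc[symmetric]
        inner_add_right sum.distrib sum_distrib_left)
  also have "\<dots> \<le> (1 - t) * nuclear_norm A1 + t * nuclear_norm A2"
    using t by (intro add_mono mult_left_mono nuclear_norm_ge_pairing C(1) parseval orth le1) auto
  finally show "nuclear_norm ((1 - t) *\<^sub>R A1 + t *\<^sub>R A2) \<le> (1 - t) * nuclear_norm A1 + t * nuclear_norm A2"
    by (simp add: A_def)
qed simp

section \<open>Subgradients and Lagrangian duality\<close>

definition subgradient :: "('a::real_inner \<Rightarrow> real) \<Rightarrow> 'a \<Rightarrow> 'a \<Rightarrow> bool" where
  "subgradient f x v \<longleftrightarrow> (\<forall>y. f x + v \<bullet> (y - x) \<le> f y)"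

lemma subgradientD: "subgradient f x v \<Longrightarrow> f x + v \<bullet> (y - x) \<le> f y"
  by (simp add: subgradient_def)

lemma subgradient_monotone:
  assumes "subgradient f x u" and "subgradient f y v"
  shows "0 \<le> (u - v) \<bullet> (x - y)"
  using subgradientD[OF assms(1), of y] subgradientD[OF assms(2), of x]
  by (simp add: inner_diff_left inner_diff_right)

text \<open>
  If \<open>x\<close> minimises \<open>f\<close> plus a smooth term with gradient \<open>w\<close> at \<open>x\<close>, then \<open>-w\<close> is a subgradient of
  \<open>f\<close>: along the segment towards \<open>y\<close> the quadratic remainder is of second order, whereas convexity
  bounds the growth of \<open>f\<close> to first order.
\<close>
lemma subgradient_of_quadratic_perturbation:
  fixes f :: "'a::real_inner \<Rightarrow> real"
  assumes "convex_on UNIV f" and min: "\<And>y. f x \<le> f y + w \<bullet> (y - x) + c * (norm (y - x))\<^sup>2"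
  shows "subgradient f x (- w)"
  unfolding subgradient_def
proof
  fix y
  have "0 \<le> f y - f x + w \<bullet> (y - x)"
  proof (rule nonneg_slope_at_zero)
    fix t :: real
    assume t: "0 < t" "t \<le> 1"
    define z where "z = (1 - t) *\<^sub>R x + t *\<^sub>R y"
    have z: "z - x = t *\<^sub>R (y - x)"
      by (simp add: z_def algebra_simps)
    have "f z \<le> (1 - t) * f x + t * f y"
      unfolding z_def using assms(1) t by (intro convex_onD) auto
    moreover have "f x \<le> f z + t * (w \<bullet> (y - x)) + t\<^sup>2 * (c * (norm (y - x))\<^sup>2)"
      using min[of z] by (simp add: z power_mult_distrib mult_ac)
    ultimately show "0 \<le> t * (f y - f x + w \<bullet> (y - x)) + t\<^sup>2 * (c * (norm (y - x))\<^sup>2)"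
      by (simp add: algebra_simps)
  qed
  then show "f x + - w \<bullet> (y - x) \<le> f y"
    by simp
qed

lemma half_norm_square_shift:
  fixes p q h :: "'a::real_inner"
  assumes "q = p + h"
  shows "c / 2 * (norm q)\<^sup>2 = c / 2 * (norm p)\<^sup>2 + (c *\<^sub>R p) \<bullet> h + c / 2 * (norm h)\<^sup>2"
  unfolding power2_norm_eq_inner assms
  by (simp add: inner_add_left inner_add_right inner_commute algebra_simps)

lemma convex_on_norm_square_affine:
  fixes h :: "'a::real_vector \<Rightarrow> 'b::real_inner"
  assumes "\<And>t x y. h ((1 - t) *\<^sub>R x + t *\<^sub>R y) = (1 - t) *\<^sub>R h x + t *\<^sub>R h y"
  shows "convex_on UNIV (\<lambda>x. (norm (h x))\<^sup>2)"
proof (rule convex_onI)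
  fix t :: real and x y
  assume "0 < t" "t < 1"
  then have "0 \<le> t * (1 - t) * (norm (h x - h y))\<^sup>2"
    by simp
  also have "\<dots> = (1 - t) * (norm (h x))\<^sup>2 + t * (norm (h y))\<^sup>2
      - (norm ((1 - t) *\<^sub>R h x + t *\<^sub>R h y))\<^sup>2"
    unfolding power2_norm_eq_inner
    by (simp add: inner_diff_left inner_diff_right inner_add_left inner_add_right inner_commute)
      (simp add: algebra_simps)
  finally show "(norm (h ((1 - t) *\<^sub>R x + t *\<^sub>R y)))\<^sup>2 \<le> (1 - t) * (norm (h x))\<^sup>2 + t * (norm (h y))\<^sup>2"
    by (simp add: assms)
qed simp

text \<open>
  Strong duality for one scalar constraint.  A point with \<open>G x > 0\<close> bounds the multiplier from below
  by \<open>(p - F x) / G x\<close>, and a point with \<open>G y < 0\<close> bounds it from above by \<open>(F y - p) / (- G y)\<close>.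
  Every lower bound is below every upper bound, because the segment from \<open>x\<close> to \<open>y\<close> contains a point
  satisfying the constraint.  The Slater point makes the set of lower bounds bounded, so its
  supremum is a multiplier.
\<close>
lemma slater_multiplier:
  fixes F G :: "'a::real_vector \<Rightarrow> real"
  assumes F: "convex_on UNIV F" and G: "convex_on UNIV G" and slater: "G x0 < 0"
    and lower: "\<And>x. G x \<le> 0 \<Longrightarrow> p \<le> F x"
  obtains t where "0 \<le> t" "\<And>x. p \<le> F x + t * G x"
proof -
  define R where "R = insert 0 ((\<lambda>x. (p - F x) / G x) ` {x. 0 < G x})"
  have upper: "r \<le> (F y - p) / (- G y)" if r: "r \<in> R" and y: "G y < 0" for r y
  proof (cases "r = 0")
    case True
    then show ?thesis
      using lower[of y] y by (simp add: divide_nonneg_neg divide_nonneg_pos)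
  next
    case False
    with r obtain x where x: "0 < G x" and r: "r = (p - F x) / G x"
      by (auto simp: R_def)
    \<comment> \<open>the point of the segment from \<open>x\<close> to \<open>y\<close> at which the chord of \<open>G\<close> vanishes\<close>
    define u where "u = G x / (G x - G y)"
    define z where "z = (1 - u) *\<^sub>R x + u *\<^sub>R y"
    have d: "0 < G x - G y"
      using x y by simp
    have u: "0 \<le> u" "u \<le> 1"
      using x y by (auto simp: u_def field_simps)
    have u': "1 - u = - G y / (G x - G y)"
      using d by (simp add: u_def field_simps)
    have "G z \<le> (1 - u) * G x + u * G y"
      unfolding z_def using G u by (intro convex_onD) auto
    also have "\<dots> = 0"
      unfolding u' by (simp add: u_def)
    finally have "p \<le> F z"
      by (rule lower)
    also have "\<dots> \<le> (1 - u) * F x + u * F y"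
      unfolding z_def using F u by (intro convex_onD) auto
    also have "\<dots> = (- G y * F x + G x * F y) / (G x - G y)"
      unfolding u' by (simp add: u_def add_divide_distrib diff_divide_distrib)
    finally have "p * (G x - G y) \<le> - G y * F x + G x * F y"
      using d by (simp add: pos_le_divide_eq)
    then show ?thesis
      unfolding r using x y by (simp add: field_simps)
  qed
  define t where "t = Sup R"
  have bdd: "bdd_above R"
    using upper[OF _ slater] by (rule bdd_aboveI)
  have R0: "0 \<in> R"
    by (simp add: R_def)
  then have "0 \<le> t"
    unfolding t_def using bdd by (rule cSup_upper)
  moreover have "p \<le> F x + t * G x" for x
  proof -
    consider "0 < G x" | "G x = 0" | "G x < 0"
      by linarith
    then show ?thesis
    proof cases
      case 1
      then have "(p - F x) / G x \<le> t"
        unfolding t_def by (intro cSup_upper bdd) (auto simp: R_def)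
      with 1 show ?thesis
        by (simp add: field_simps)
    next
      case 2
      then show ?thesis
        using lower[of x] by simp
    next
      case 3
      then have "t \<le> (F x - p) / (- G x)"
        unfolding t_def using R0 upper by (intro cSup_least) auto
      with 3 show ?thesis
        by (simp add: field_simps)
    qed
  qed
  ultimately show ?thesis
    by (rule that)
qed

text \<open>
  Since some multiplier reaches the primal value, so does every maximiser of the dual function; the
  primal solution then minimises the Lagrangian and complementary slackness holds.
\<close>
lemma optimal_dual_variable_is_multiplier:
  fixes F G :: "'a::real_vector \<Rightarrow> real"
  assumes F: "convex_on UNIV F" and G: "convex_on UNIV G" and slater: "G x0 < 0"
    and min: "is_arg_min F (\<lambda>x. G x \<le> 0) x" and dual: "optimal_dual_variable F G t"
  shows "0 \<le> t" and "t * G x = 0" and "F x \<le> F y + t * G y"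
proof -
  have Gx: "G x \<le> 0" and lower: "\<And>y. G y \<le> 0 \<Longrightarrow> F x \<le> F y"
    using min by (auto simp: is_arg_min_linorder)
  obtain s where "0 \<le> s" and s: "\<And>y. F x \<le> F y + s * G y"
    using slater_multiplier[where p = "F x" and F = F and G = G] F G slater lower by blast
  show t: "0 \<le> t"
    using dual by (simp add: optimal_dual_variable_def is_arg_max_def)
  have "ereal (F x) \<le> lagrange_dual_function F G s"
    unfolding lagrange_dual_function_def using s by (intro INF_greatest) simp
  also have "\<dots> \<le> lagrange_dual_function F G t"
    using dual \<open>0 \<le> s\<close> by (auto simp: optimal_dual_variable_def is_arg_max_linorder)
  finally have le: "ereal (F x) \<le> lagrange_dual_function F G t" .
  show *: "F x \<le> F y + t * G y" for y
  proof -
    have "lagrange_dual_function F G t \<le> ereal (F y + t * G y)"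
      unfolding lagrange_dual_function_def by (rule INF_lower) simp
    with le show ?thesis
      by (metis ereal_less_eq(3) order_trans)
  qed
  show "t * G x = 0"
    using *[of x] mult_nonneg_nonpos[OF t Gx] by simp
qed

section \<open>The constrained problem and its optimality conditions\<close>

text \<open>
  The setting to which the convergence proof applies: the nuclear norm becomes any nonnegative convex
  \<open>f\<close>, and the weighted entrywise norm any positively homogeneous subadditive \<open>g\<close> that is equivalent
  to the Euclidean norm.
\<close>
locale stable_decomposition =
  fixes f g :: "'a::euclidean_space \<Rightarrow> real" and D :: 'a and \<delta> a b :: real
  assumes convex_f: "convex_on UNIV f" and f_nonneg: "0 \<le> f x"
    and g_add: "g (x + y) \<le> g x + g y"
    and g_scale: "0 \<le> t \<Longrightarrow> g (t *\<^sub>R x) = t * g x"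
    and a_pos: "0 < a" and g_lower: "a * norm x \<le> g x" and g_upper: "g x \<le> b * norm x"
    and \<delta>_pos: "0 < \<delta>"
begin

definition feasible :: "'a \<Rightarrow> 'a \<Rightarrow> bool" where
  "feasible Z S \<longleftrightarrow> norm (Z + S - D) \<le> \<delta>"

definition optimal :: "'a \<Rightarrow> 'a \<Rightarrow> bool" where
  "optimal X S \<longleftrightarrow> feasible X S \<and> (\<forall>X' S'. feasible X' S' \<longrightarrow> f X + g S \<le> f X' + g S')"

text \<open>
  With \<open>h Z\<close> the least value of \<open>g S\<close> over all \<open>S\<close> with \<open>feasible Z S\<close>, this says that \<open>S\<close> attains
  \<open>h Z\<close> and that \<open>Y\<close> is a subgradient of the convex function \<open>h\<close> at \<open>Z\<close>.  In terms of \<open>h\<close> the problem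
  is to minimise \<open>f + h\<close>.
\<close>
definition supports :: "'a \<Rightarrow> 'a \<Rightarrow> 'a \<Rightarrow> bool" where
  "supports Z S Y \<longleftrightarrow> feasible Z S \<and> (\<forall>Z' S'. feasible Z' S' \<longrightarrow> g S + Y \<bullet> (Z' - Z) \<le> g S')"

definition kkt :: "'a \<Rightarrow> 'a \<Rightarrow> 'a \<Rightarrow> real \<Rightarrow> bool" where
  "kkt Z S Y \<theta> \<longleftrightarrow> feasible Z S \<and> 0 \<le> \<theta> \<and> \<theta> * ((norm (Z + S - D))\<^sup>2 - \<delta>\<^sup>2) = 0 \<and>
     Y = \<theta> *\<^sub>R (Z + S - D) \<and> subgradient g S (- Y)"

lemma convex_g: "convex_on UNIV g"
proof (rule convex_onI)
  fix t :: real and x y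
  assume "0 < t" "t < 1"
  then show "g ((1 - t) *\<^sub>R x + t *\<^sub>R y) \<le> (1 - t) * g x + t * g y"
    using g_add[of "(1 - t) *\<^sub>R x" "t *\<^sub>R y"] by (simp add: g_scale)
qed simp

lemma continuous_f: "continuous_on UNIV f" and continuous_g: "continuous_on UNIV g"
  by (auto intro!: convex_on_continuous convex_f convex_g)

lemma g_zero: "g 0 = 0"
  using g_scale[of 0 0] by simp

lemma g_pos: "x \<noteq> 0 \<Longrightarrow> 0 < g x"
  using g_lower[of x] a_pos by (metis less_le_trans mult_pos_pos zero_less_norm_iff)

lemma g_nonneg: "0 \<le> g x"
  using g_pos[of x] g_zero by (cases "x = 0") auto

lemma subgradient_g_norm_le:
  assumes "subgradient g S v"
  shows "norm v \<le> b"
proof (cases "v = 0")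
  case True
  have "0 \<le> b" if "x \<noteq> 0" for x :: 'a
    using g_pos[OF that] g_upper[of x] that
    by (metis less_le_trans norm_not_less_zero zero_less_mult_iff order_less_imp_le)
  then show ?thesis
    using True nonempty_Basis nonzero_Basis by (metis all_not_in_conv norm_zero)
next
  case False
  have "v \<bullet> v \<le> g (S + v) - g S"
    using subgradientD[OF assms, of "S + v"] by simp
  also have "\<dots> \<le> b * norm v"
    using g_add[of S v] g_upper[of v] by simp
  finally show ?thesis
    using False by (simp add: dot_square_norm power2_eq_square)
qed

text \<open>
  Euler's identity for a positively homogeneous function.
\<close>
lemma subgradient_g_euler:
  assumes "subgradient g S v"
  shows "v \<bullet> S = g S"
  using subgradientD[OF assms, of 0] subgradientD[OF assms, of "2 *\<^sub>R S"] g_scale[of 2 S] g_zero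
  by (simp add: inner_diff_right)

text \<open>
  The term \<open>\<theta>/2 |Z + S - D|\<^sup>2\<close> is convex with gradient \<open>Y\<close> in both arguments, and by complementary
  slackness no feasible point raises it above its value at \<open>(Z, S)\<close>.  Adding the subgradient
  inequality for \<open>g\<close> cancels the dependence on the sparse component.
\<close>
lemma kkt_supports:
  assumes "kkt Z S Y \<theta>"
  shows "supports Z S Y"
  unfolding supports_def
proof (intro conjI allI impI)
  show "feasible Z S"
    using assms by (simp add: kkt_def)
  fix Z' S' assume "feasible Z' S'"
  define r r' where "r = Z + S - D" and "r' = Z' + S' - D"
  have \<theta>: "0 \<le> \<theta>" "\<theta> * ((norm r)\<^sup>2 - \<delta>\<^sup>2) = 0" and Y: "Y = \<theta> *\<^sub>R r" and sub: "subgradient g S (- Y)"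
    using assms by (auto simp: kkt_def r_def)
  have shift: "r' = r + (r' - r)"
    by simp
  have "\<theta> / 2 * (norm r')\<^sup>2 \<le> \<theta> / 2 * \<delta>\<^sup>2"
    using \<open>feasible Z' S'\<close> \<theta>(1) by (intro mult_left_mono) (auto simp: feasible_def r'_def power_mono)
  moreover have "\<theta> / 2 * \<delta>\<^sup>2 = \<theta> / 2 * (norm r)\<^sup>2"
    using \<theta>(2) by auto
  moreover have "0 \<le> \<theta> / 2 * (norm (r' - r))\<^sup>2"
    using \<theta>(1) by simp
  ultimately have "Y \<bullet> (r' - r) \<le> 0"
    using half_norm_square_shift[OF shift, of \<theta>] unfolding Y by linarith
  moreover have "r' - r = (Z' - Z) + (S' - S)"
    by (simp add: r_def r'_def)
  ultimately have "Y \<bullet> (Z' - Z) \<le> - Y \<bullet> (S' - S)"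
    by (simp add: inner_add_right)
  with subgradientD[OF sub, of S'] show "g S + Y \<bullet> (Z' - Z) \<le> g S'"
    by simp
qed

lemma supports_monotone:
  assumes "supports Z S Y" and "supports Z' S' Y'"
  shows "0 \<le> (Y - Y') \<bullet> (Z - Z')"
proof -
  have "g S + Y \<bullet> (Z' - Z) \<le> g S'" "g S' + Y' \<bullet> (Z - Z') \<le> g S"
    using assms by (auto simp: supports_def)
  then show ?thesis
    by (simp add: inner_diff_left inner_diff_right)
qed

lemma convex_constraint:
  "convex_on UNIV (\<lambda>(Z, S). 1 / 2 * (norm (Z + S - D))\<^sup>2 - \<delta>\<^sup>2 / 2)"
proof -
  have "convex_on UNIV (\<lambda>p. (norm (fst p + snd p - D))\<^sup>2)"
    by (rule convex_on_norm_square_affine) (simp add: algebra_simps)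
  then have "convex_on UNIV (\<lambda>p. 1 / 2 * (norm (fst p + snd p - D))\<^sup>2 + - (\<delta>\<^sup>2 / 2))"
    by (intro convex_on_add convex_on_cmul) (auto simp: convex_on_const)
  then show ?thesis
    by (simp add: case_prod_unfold)
qed

lemma strictly_feasible: "(\<lambda>(Z, S). 1 / 2 * (norm (Z + S - D))\<^sup>2 - \<delta>\<^sup>2 / 2) (D, 0) < 0"
  using \<delta>_pos by simp

lemma constraint_iff: "1 / 2 * (norm (Z + S - D))\<^sup>2 - \<delta>\<^sup>2 / 2 \<le> 0 \<longleftrightarrow> feasible Z S"
proof -
  have "(norm (Z + S - D))\<^sup>2 \<le> \<delta>\<^sup>2 \<longleftrightarrow> norm (Z + S - D) \<le> \<delta>"
    using \<delta>_pos by (simp add: power_mono_iff)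
  then show ?thesis
    by (simp add: feasible_def)
qed

lemma subgradient_g_from_penalty:
  assumes "\<And>S'. g S + \<theta> / 2 * (norm (Z + S - D))\<^sup>2 \<le> g S' + \<theta> / 2 * (norm (Z + S' - D))\<^sup>2"
  shows "subgradient g S (- (\<theta> *\<^sub>R (Z + S - D)))"
proof (rule subgradient_of_quadratic_perturbation[OF convex_g])
  fix S'
  have "Z + S' - D = (Z + S - D) + (S' - S)"
    by simp
  from half_norm_square_shift[OF this, of \<theta>] assms[of S']
  show "g S \<le> g S' + \<theta> *\<^sub>R (Z + S - D) \<bullet> (S' - S) + \<theta> / 2 * (norm (S' - S))\<^sup>2"
    by linarith
qed

text \<open>
  A solution of the constrained step minimises its Lagrangian.  Stationarity in \<open>Z\<close>
  identifies the multiplier update \<open>Y0 + r (X - Z)\<close> with \<open>\<theta> (Z + S - D)\<close>, and stationarity in \<open>S\<close>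
  makes the negative of the same matrix a subgradient of \<open>g\<close>.
\<close>
lemma ZS_step_kkt:
  assumes min: "is_arg_min (\<lambda>(Z, S). g S + (- Y0) \<bullet> (Z - X) + r / 2 * (norm (Z - X))\<^sup>2)
      (\<lambda>(Z, S). (norm (Z + S - D))\<^sup>2 \<le> \<delta>\<^sup>2) (Z, S)"
    and dual: "optimal_dual_variable (\<lambda>(Z, S). g S + (- Y0) \<bullet> (Z - X) + r / 2 * (norm (Z - X))\<^sup>2)
      (\<lambda>(Z, S). 1 / 2 * (norm (Z + S - D))\<^sup>2 - \<delta>\<^sup>2 / 2) \<theta>"
    and "0 < r"
  shows "kkt Z S (Y0 + r *\<^sub>R (X - Z)) \<theta>"
proof -
  let ?F = "\<lambda>(Z, S). g S + (- Y0) \<bullet> (Z - X) + r / 2 * (norm (Z - X))\<^sup>2"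
  let ?G = "\<lambda>(Z, S). 1 / 2 * (norm (Z + S - D))\<^sup>2 - \<delta>\<^sup>2 / 2"
  have "convex_on UNIV (\<lambda>p::'a \<times> 'a. g (snd p))"
    using convex_onD[OF convex_g] by (intro convex_onI) auto
  moreover have "convex_on UNIV (\<lambda>p::'a \<times> 'a. (- Y0) \<bullet> (fst p - X))"
    by (intro convex_onI) (auto simp: inner_diff_right inner_add_right algebra_simps)
  moreover have "convex_on UNIV (\<lambda>p::'a \<times> 'a. (norm (fst p - X))\<^sup>2)"
    by (rule convex_on_norm_square_affine) (simp add: algebra_simps)
  ultimately have "convex_on UNIV (\<lambda>p. g (snd p) + (- Y0) \<bullet> (fst p - X) + r / 2 * (norm (fst p - X))\<^sup>2)"
    using \<open>0 < r\<close> by (intro convex_on_add convex_on_cmul) auto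
  then have F: "convex_on UNIV ?F"
    by (simp add: case_prod_unfold)
  have "is_arg_min ?F (\<lambda>p. ?G p \<le> 0) (Z, S)"
    using min by (simp add: is_arg_min_linorder)
  note multiplier = optimal_dual_variable_is_multiplier[OF F convex_constraint strictly_feasible this dual]
  have \<theta>: "0 \<le> \<theta>" and comp: "\<theta> * ((norm (Z + S - D))\<^sup>2 - \<delta>\<^sup>2) = 0"
    using multiplier(1,2) by auto
  have lag: "g S - Y0 \<bullet> (Z - X) + r / 2 * (norm (Z - X))\<^sup>2 + \<theta> / 2 * (norm (Z + S - D))\<^sup>2
      \<le> g S' - Y0 \<bullet> (Z' - X) + r / 2 * (norm (Z' - X))\<^sup>2 + \<theta> / 2 * (norm (Z' + S' - D))\<^sup>2" for Z' S'
  proof -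
    have "\<theta> * \<delta>\<^sup>2 = \<theta> * (norm (Z + S - D))\<^sup>2"
      using comp by auto
    moreover have "g S - Y0 \<bullet> (Z - X) + r / 2 * (norm (Z - X))\<^sup>2 \<le> g S' - Y0 \<bullet> (Z' - X)
        + r / 2 * (norm (Z' - X))\<^sup>2 + \<theta> * (1 / 2 * (norm (Z' + S' - D))\<^sup>2 - \<delta>\<^sup>2 / 2)"
      using multiplier(3)[of "(Z', S')"] by simp
    ultimately show ?thesis
      unfolding right_diff_distrib by linarith
  qed
  \<comment> \<open>the gradient of the Lagrangian in \<open>Z\<close>\<close>
  define w where "w = \<theta> *\<^sub>R (Z + S - D) - (Y0 + r *\<^sub>R (X - Z))"
  have "subgradient (\<lambda>_. 0) Z (- w)"
  proof (rule subgradient_of_quadratic_perturbation)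
    fix Z'
    show "(0::real) \<le> 0 + w \<bullet> (Z' - Z) + (r / 2 + \<theta> / 2) * (norm (Z' - Z))\<^sup>2"
      using lag[where Z' = Z' and S' = S] half_norm_square_shift[of "Z' - X" "Z - X" "Z' - Z" r]
        half_norm_square_shift[of "Z' + S - D" "Z + S - D" "Z' - Z" \<theta>]
      by (simp add: w_def inner_diff_left inner_diff_right inner_add_left algebra_simps)
  qed (simp add: convex_on_const)
  from subgradientD[OF this, of "Z - w"] have "w = 0"
    using inner_ge_zero[of w] by (simp add: order_antisym)
  then have "Y0 + r *\<^sub>R (X - Z) = \<theta> *\<^sub>R (Z + S - D)"
    by (simp add: w_def)
  moreover have "subgradient g S (- (\<theta> *\<^sub>R (Z + S - D)))"
    using lag[where Z' = Z] by (intro subgradient_g_from_penalty) simp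
  moreover have "feasible Z S"
    using min constraint_iff by (simp add: is_arg_min_def)
  ultimately show ?thesis
    using \<theta> comp by (simp add: kkt_def)
qed

lemma X_step_subgradient:
  assumes "is_arg_min (\<lambda>X. f X + Y0 \<bullet> (X - Z0) + r / 2 * (norm (X - Z0))\<^sup>2) (\<lambda>_. True) X"
  shows "subgradient f X (- (Y0 + r *\<^sub>R (X - Z0)))"
proof (rule subgradient_of_quadratic_perturbation[OF convex_f])
  fix X'
  have "f X + Y0 \<bullet> (X - Z0) + r / 2 * (norm (X - Z0))\<^sup>2
      \<le> f X' + Y0 \<bullet> (X' - Z0) + r / 2 * (norm (X' - Z0))\<^sup>2"
    using assms by (simp add: is_arg_min_linorder)
  moreover have "Y0 \<bullet> (X' - Z0) = Y0 \<bullet> (X - Z0) + Y0 \<bullet> (X' - X)"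
    by (simp add: inner_diff_right)
  moreover have "X' - Z0 = (X - Z0) + (X' - X)"
    by simp
  note half_norm_square_shift[OF this, of r]
  ultimately show "f X \<le> f X' + (Y0 + r *\<^sub>R (X - Z0)) \<bullet> (X' - X) + r / 2 * (norm (X' - X))\<^sup>2"
    unfolding inner_add_left by linarith
qed

text \<open>
  The scalar multiplier \<open>\<theta>\<close> of the norm constraint already determines the multiplier \<open>Y\<close> of the splitting
  constraint \<open>X = Z\<close>, as \<open>Y = \<theta> (X + S - D)\<close>, because the penalised problem is smooth apart
  from \<open>f\<close> and \<open>g\<close>.
\<close>
lemma optimal_multiplier:
  assumes opt: "optimal X S"
  obtains Y \<theta> where "kkt X S Y \<theta>" "subgradient f X (- Y)"
proof -
  have feas: "feasible X S" and lower: "\<And>X' S'. feasible X' S' \<Longrightarrow> f X + g S \<le> f X' + g S'"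
    using opt by (auto simp: optimal_def)
  have F: "convex_on UNIV (\<lambda>(X, S). f X + g S)"
  proof (rule convex_onI, clarsimp)
    fix t :: real and x y x' y'
    assume t: "0 < t" "t < 1"
    show "f ((1 - t) *\<^sub>R x + t *\<^sub>R x') + g ((1 - t) *\<^sub>R y + t *\<^sub>R y')
        \<le> (1 - t) * (f x + g y) + t * (f x' + g y')"
      using convex_onD[OF convex_f, of t x x'] convex_onD[OF convex_g, of t y y'] t
      by (simp add: distrib_left)
  qed simp
  obtain \<theta> where \<theta>: "0 \<le> \<theta>"
    and lag0: "\<And>p. f X + g S \<le> (\<lambda>(X, S). f X + g S) p
      + \<theta> * (\<lambda>(Z, S). 1 / 2 * (norm (Z + S - D))\<^sup>2 - \<delta>\<^sup>2 / 2) p"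
    using slater_multiplier[OF F convex_constraint strictly_feasible, of "f X + g S"] lower constraint_iff
    by (smt (verit) case_prod_unfold prod.collapse)
  define r where "r = X + S - D"
  have "\<theta> * (1 / 2 * (norm r)\<^sup>2 - \<delta>\<^sup>2 / 2) = 0"
    using lag0[of "(X, S)"] mult_nonneg_nonpos[OF \<theta>, of "1 / 2 * (norm r)\<^sup>2 - \<delta>\<^sup>2 / 2"] feas
      constraint_iff[of X S] by (simp add: r_def)
  then have comp: "\<theta> * ((norm r)\<^sup>2 - \<delta>\<^sup>2) = 0"
    by simp
  then have lag: "f X + g S + \<theta> / 2 * (norm r)\<^sup>2 \<le> f X' + g S' + \<theta> / 2 * (norm (X' + S' - D))\<^sup>2" for X' S'
  proof -
    have "\<theta> * \<delta>\<^sup>2 = \<theta> * (norm r)\<^sup>2"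
      using comp by auto
    moreover have "f X + g S \<le> f X' + g S' + \<theta> * (1 / 2 * (norm (X' + S' - D))\<^sup>2 - \<delta>\<^sup>2 / 2)"
      using lag0[of "(X', S')"] by simp
    ultimately show ?thesis
      unfolding right_diff_distrib by linarith
  qed
  have "subgradient g S (- (\<theta> *\<^sub>R r))"
    unfolding r_def using lag[where X' = X] by (intro subgradient_g_from_penalty) (simp add: r_def)
  with feas \<theta> comp have "kkt X S (\<theta> *\<^sub>R r) \<theta>"
    by (simp add: kkt_def r_def)
  moreover have "subgradient f X (- (\<theta> *\<^sub>R r))"
  proof (rule subgradient_of_quadratic_perturbation[OF convex_f])
    fix X'
    have shift: "X' + S - D = r + (X' - X)"
      by (simp add: r_def)
    show "f X \<le> f X' + \<theta> *\<^sub>R r \<bullet> (X' - X) + \<theta> / 2 * (norm (X' - X))\<^sup>2"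
      using lag[of X' S] half_norm_square_shift[OF shift, of \<theta>] by linarith
  qed
  ultimately show ?thesis
    by (rule that)
qed

text \<open>
  On the sublevel set through \<open>(D, 0)\<close> the lower bound on \<open>g\<close> controls \<open>S\<close>, and the constraint then
  controls \<open>X\<close>, so this set is compact.
\<close>
lemma optimal_exists: obtains X S where "optimal X S"
proof -
  \<comment> \<open>the objective value at the feasible point \<open>(D, 0)\<close>\<close>
  define v where "v = f D + g 0"
  define K where "K = {p. norm (fst p + snd p - D) \<le> \<delta> \<and> f (fst p) + g (snd p) \<le> v}"
  have cont: "continuous_on UNIV (\<lambda>p::'a \<times> 'a. f (fst p) + g (snd p))"
    by (intro continuous_intros continuous_on_compose2[OF continuous_f]
        continuous_on_compose2[OF continuous_g]) auto
  have "closed K"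
    unfolding K_def
    by (intro closed_Collect_conj closed_Collect_le continuous_intros cont)
  moreover have "bounded K"
  proof -
    have "norm p \<le> (\<delta> + v / a + norm D) + v / a" if p: "p \<in> K" for p
    proof -
      have "a * norm (snd p) \<le> v"
        using p f_nonneg[of "fst p"] g_lower[of "snd p"] by (simp add: K_def)
      then have s: "norm (snd p) \<le> v / a"
        using a_pos by (simp add: field_simps)
      have "norm (fst p) \<le> norm (fst p + snd p - D) + norm (snd p) + norm D"
        using norm_triangle_ineq4[of "fst p + snd p - D" "snd p - D"] norm_triangle_ineq4[of "snd p" D]
        by (simp add: algebra_simps)
      also have "\<dots> \<le> \<delta> + v / a + norm D"
        using p s by (simp add: K_def)
      finally show ?thesis
        using s norm_Pair_le[of "fst p" "snd p"] by simp
    qed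
    then show ?thesis
      by (rule boundedI)
  qed
  ultimately have "compact K"
    by (simp add: compact_eq_bounded_closed)
  moreover have "(D, 0) \<in> K"
    using \<delta>_pos by (simp add: K_def v_def)
  ultimately obtain q where q: "q \<in> K" and qmin: "\<And>p. p \<in> K \<Longrightarrow> f (fst q) + g (snd q) \<le> f (fst p) + g (snd p)"
    using continuous_attains_inf[of K "\<lambda>p. f (fst p) + g (snd p)"] continuous_on_subset[OF cont]
    by (metis empty_iff subset_UNIV)
  have "f (fst q) + g (snd q) \<le> f X' + g S'" if "feasible X' S'" for X' S'
    using qmin[of "(X', S')"] q that
    by (cases "(X', S') \<in> K") (auto simp: K_def feasible_def)
  then have "optimal (fst q) (snd q)"
    using q by (auto simp: optimal_def feasible_def K_def)
  then show ?thesis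
    by (rule that)
qed

text \<open>
  A minimiser of \<open>g\<close> over a Euclidean ball is unique: the midpoint of two minimisers would lie
  strictly inside the ball, and could be shrunk towards \<open>0\<close>, which lowers \<open>g\<close>.
\<close>
lemma least_g_unique:
  assumes S1: "feasible Z S1" "\<And>S'. feasible Z S' \<Longrightarrow> g S1 \<le> g S'"
    and S2: "feasible Z S2" "g S2 \<le> g S1"
  shows "S1 = S2"
proof (rule ccontr)
  assume ne: "S1 \<noteq> S2"
  define M where "M = (1 / 2) *\<^sub>R (S1 + S2)"
  have "0 < g S1"
  proof -
    consider "S1 \<noteq> 0" | "S2 \<noteq> 0"
      using ne by auto
    then show ?thesis
      using g_pos S2(2) by cases (auto intro: less_le_trans)
  qed
  have gM: "g M \<le> g S1"
    using g_add[of S1 S2] S2(2) by (simp add: M_def g_scale)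
  define p q where "p = Z + S1 - D" and "q = Z + S2 - D"
  have "(norm (p + q))\<^sup>2 = 2 * (norm p)\<^sup>2 + 2 * (norm q)\<^sup>2 - (norm (p - q))\<^sup>2"
    unfolding power2_norm_eq_inner
    by (simp add: inner_diff_left inner_diff_right inner_add_left inner_add_right inner_commute)
  also have "\<dots> < 2 * \<delta>\<^sup>2 + 2 * \<delta>\<^sup>2"
  proof -
    have "(norm p)\<^sup>2 \<le> \<delta>\<^sup>2" "(norm q)\<^sup>2 \<le> \<delta>\<^sup>2"
      using S1(1) S2(1) by (auto simp: feasible_def p_def q_def intro: power_mono)
    moreover have "0 < (norm (p - q))\<^sup>2"
      using ne by (simp add: p_def q_def)
    ultimately show ?thesis by linarith
  qed
  finally have "(norm (p + q))\<^sup>2 < (2 * \<delta>)\<^sup>2"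
    by (simp add: power_mult_distrib)
  then have "norm (p + q) < 2 * \<delta>"
    by (rule power2_less_imp_less) (use \<delta>_pos in simp)
  moreover have "p + q = 2 *\<^sub>R (Z + M - D)"
    by (simp add: p_def q_def M_def algebra_simps scaleR_2)
  ultimately have slack: "norm (Z + M - D) < \<delta>"
    by simp
  \<comment> \<open>shrinking the strictly feasible midpoint towards \<open>0\<close> keeps it feasible and lowers \<open>g\<close>\<close>
  define e where "e = min 1 ((\<delta> - norm (Z + M - D)) / (norm M + 1))"
  have e: "0 < e" "e \<le> 1"
    using slack by (auto simp: e_def add_nonneg_pos)
  have "e * norm M \<le> e * (norm M + 1)"
    using e by simp
  also have "\<dots> \<le> \<delta> - norm (Z + M - D)"
  proof -
    have "e \<le> (\<delta> - norm (Z + M - D)) / (norm M + 1)"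
      by (simp add: e_def)
    then show ?thesis
      by (simp add: pos_le_divide_eq add_nonneg_pos)
  qed
  finally have "feasible Z ((1 - e) *\<^sub>R M)"
    using norm_triangle_ineq4[of "Z + M - D" "e *\<^sub>R M"] e
    by (simp add: feasible_def algebra_simps)
  then have "g S1 \<le> (1 - e) * g M"
    using S1(2) e by (simp flip: g_scale)
  also have "\<dots> \<le> (1 - e) * g S1"
    using gM e by (intro mult_left_mono) auto
  also have "\<dots> < g S1"
    using e \<open>0 < g S1\<close> by simp
  finally show False
    by simp
qed

end

section \<open>Convergence of real and vector sequences\<close>

lemma summable_of_telescoping_descent:
  fixes V u :: "nat \<Rightarrow> real"
  assumes descent: "\<And>k. V (Suc k) + u k \<le> V k" and V: "\<And>k. 0 \<le> V k" and u: "\<And>k. 0 \<le> u k"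
  shows "summable u"
proof (rule summableI_nonneg_bounded)
  fix n
  have "(\<Sum>k<n. u k) + V n \<le> V 0"
  proof (induction n)
    case (Suc n)
    then show ?case
      using descent[of n] by simp
  qed simp
  then show "(\<Sum>k<n. u k) \<le> V 0"
    using V[of n] by linarith
qed (rule u)

text \<open>
  If \<open>c\<close> stayed above some \<open>e > 0\<close> from an index on, the weights would be summable.
\<close>
lemma null_subsequence_of_weighted_sum:
  fixes w c :: "nat \<Rightarrow> real"
  assumes div: "filterlim (\<lambda>N. \<Sum>k=1..N. w k) at_top sequentially" and w: "\<And>k. 0 \<le> w k"
    and c: "\<And>k. 1 \<le> k \<Longrightarrow> 0 \<le> c k" and sum: "summable (\<lambda>k. w k * c k)"
  obtains r where "strict_mono r" "(\<lambda>n. c (r n)) \<longlonglongrightarrow> 0"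
proof -
  have small: "\<exists>k\<ge>N. c k < e" if "0 < e" for e N
  proof (rule ccontr)
    assume "\<not> (\<exists>k\<ge>N. c k < e)"
    then have large: "e \<le> c k" if "N \<le> k" for k
      using that by (meson not_less)
    have dominated: "norm (w k) \<le> 1 / e * (w k * c k)" if "N \<le> k" for k
      using mult_left_mono[OF large[OF that] w[of k]] w[of k] \<open>0 < e\<close>
      by (simp add: pos_le_divide_eq)
    have "summable w"
      by (rule summable_comparison_test'[OF summable_mult[OF sum, of "1 / e"] dominated])
    then have "(\<Sum>k=1..n. w k) \<le> suminf w" for n
      using w by (intro sum_le_suminf) auto
    moreover obtain n where "suminf w + 1 \<le> (\<Sum>k=1..n. w k)"
      using div unfolding filterlim_at_top eventually_sequentially by (meson order_refl)
    ultimately show False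
      by (metis add_le_same_cancel1 not_one_le_zero order_trans)
  qed
  have "\<exists>r. \<forall>n. (1 \<le> r n \<and> c (r n) < inverse (real (Suc n))) \<and> r n < r (Suc n)"
  proof (rule dependent_nat_choice)
    show "\<exists>k. 1 \<le> k \<and> c k < inverse (real (Suc 0))"
      using small[of 1 1] by auto
    fix k n :: nat
    obtain m where "Suc k \<le> m" "c m < inverse (real (Suc (Suc n)))"
      using small[of "inverse (real (Suc (Suc n)))" "Suc k"] by auto
    then show "\<exists>m. (1 \<le> m \<and> c m < inverse (real (Suc (Suc n)))) \<and> k < m"
      by (intro exI[of _ m]) simp
  qed
  then obtain r where r: "\<And>n. 1 \<le> r n" "\<And>n. c (r n) < inverse (real (Suc n))" "\<And>n. r n < r (Suc n)"
    by blast
  have "(\<lambda>n. c (r n)) \<longlonglongrightarrow> 0"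
  proof (rule tendsto_sandwich[OF _ _ tendsto_const LIMSEQ_inverse_real_of_nat])
    show "\<forall>\<^sub>F n in sequentially. 0 \<le> c (r n)"
      using c r(1) by simp
    show "\<forall>\<^sub>F n in sequentially. c (r n) \<le> inverse (real (Suc n))"
      using r(2) by (simp add: less_imp_le)
  qed
  moreover have "strict_mono r"
    using r(3) by (simp add: strict_mono_Suc_iff)
  ultimately show ?thesis
    using that by blast
qed

lemma bounded_unique_limit_point_tendsto:
  fixes s :: "nat \<Rightarrow> 'a::heine_borel"
  assumes bdd: "bounded (range s)"
    and uniq: "\<And>r l'. strict_mono r \<Longrightarrow> (\<lambda>n. s (r n)) \<longlonglongrightarrow> l' \<Longrightarrow> l' = l"
  shows "s \<longlonglongrightarrow> l"
proof (rule ccontr)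
  assume "\<not> s \<longlonglongrightarrow> l"
  then obtain e where e: "0 < e" and far: "\<And>N. \<exists>n\<ge>N. e \<le> dist (s n) l"
    unfolding lim_sequentially by (meson not_less)
  have "infinite {n. e \<le> dist (s n) l}"
    unfolding infinite_nat_iff_unbounded_le using far by simp
  then obtain r :: "nat \<Rightarrow> nat" where r: "strict_mono r" "\<And>n. e \<le> dist (s (r n)) l"
    using infinite_enumerate by blast
  have "bounded (range (s \<circ> r))"
    using bdd by (rule bounded_subset) auto
  then obtain l' q where q: "strict_mono q" "((s \<circ> r) \<circ> q) \<longlonglongrightarrow> l'"
    using bounded_imp_convergent_subsequence by blast
  then have lim: "(\<lambda>n. s ((r \<circ> q) n)) \<longlonglongrightarrow> l'"
    by (simp add: comp_def)
  have "l' = l"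
    using uniq[OF strict_mono_o[OF r(1) q(1)] lim] .
  have "(\<lambda>n. dist (s ((r \<circ> q) n)) l) \<longlonglongrightarrow> dist l' l"
    by (intro tendsto_intros lim)
  then have "e \<le> dist l' l"
    by (rule LIMSEQ_le_const) (use r(2) in auto)
  with e \<open>l' = l\<close> show False
    by simp
qed

text \<open>
  Fejer monotonicity turns convergence along a subsequence into convergence: the energy below is
  decreasing, so it tends to zero as soon as a subsequence does.
\<close>
lemma decseq_tendsto_of_subseq:
  fixes a :: "nat \<Rightarrow> real"
  assumes "decseq a" and "\<And>n. 0 \<le> a n" and "strict_mono r" and "(\<lambda>n. a (r n)) \<longlonglongrightarrow> l"
  shows "a \<longlonglongrightarrow> l"
proof -
  obtain L where "a \<longlonglongrightarrow> L"
    using decseq_convergent[of a 0] assms(1,2) by blast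
  with LIMSEQ_subseq_LIMSEQ[OF this assms(3)] assms(4) show ?thesis
    by (metis LIMSEQ_unique comp_def ext)
qed

section \<open>Convergence of the iterates\<close>

text \<open>
  The energy identity of the alternating direction method, in increments: \<open>p\<close> and \<open>u\<close> are the errors of
  \<open>Z\<close> and \<open>Y\<close> before the step, \<open>d\<close> is the increment of \<open>Z\<close>, and \<open>h\<close> is the residual \<open>X - Z\<close> after the
  step, so that \<open>r h\<close> is the increment of \<open>Y\<close>.
\<close>
lemma admm_energy_identity:
  fixes p d h u :: "'a::real_inner" and r :: real
  assumes "0 < r"
  shows "(norm (p + d))\<^sup>2 + (norm (u + r *\<^sub>R h))\<^sup>2 / r\<^sup>2 + ((norm d)\<^sup>2 + (norm h)\<^sup>2
      + 2 / r * ((u + r *\<^sub>R h) \<bullet> (p + d) - (u + r *\<^sub>R (d + h)) \<bullet> (p + d + h)))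
    = (norm p)\<^sup>2 + (norm u)\<^sup>2 / r\<^sup>2 - 2 * (h \<bullet> d)"
proof -
  have "(norm (u + r *\<^sub>R h))\<^sup>2 / r\<^sup>2 = (norm u)\<^sup>2 / r\<^sup>2 + 2 / r * (u \<bullet> h) + (norm h)\<^sup>2"
    using assms unfolding power2_norm_eq_inner
    by (simp add: inner_add_left inner_add_right inner_commute field_simps power2_eq_square)
  moreover have "2 / r * ((u + r *\<^sub>R h) \<bullet> (p + d) - (u + r *\<^sub>R (d + h)) \<bullet> (p + d + h))
      = - (2 / r * (u \<bullet> h)) - 2 * (d \<bullet> p + (norm d)\<^sup>2 + d \<bullet> h + (norm h)\<^sup>2)"
    using assms unfolding power2_norm_eq_inner
    by (simp add: inner_add_left inner_add_right inner_commute field_simps)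
  moreover have "(norm (p + d))\<^sup>2 = (norm p)\<^sup>2 + 2 * (d \<bullet> p) + (norm d)\<^sup>2"
    unfolding power2_norm_eq_inner by (simp add: inner_add_left inner_add_right inner_commute)
  ultimately show ?thesis
    by (simp add: inner_commute[of d h])
qed

text \<open>
  The subproblems of the algorithm enter only through their optimality conditions.  The vector
  \<open>Y k + \<rho> k (X (k + 1) - Z k)\<close> is the intermediate multiplier of the algorithm.
\<close>
locale nsa_iteration = stable_decomposition f g D \<delta> a b
  for f g :: "'a::euclidean_space \<Rightarrow> real" and D :: 'a and \<delta> a b :: real +
  fixes X Z S Y :: "nat \<Rightarrow> 'a" and \<theta> \<rho> :: "nat \<Rightarrow> real"
  assumes rho_0: "0 < \<rho> 0" and rho_Suc: "\<rho> k \<le> \<rho> (Suc k)"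
    and X_step: "subgradient f (X (Suc k)) (- (Y k + \<rho> k *\<^sub>R (X (Suc k) - Z k)))"
    and ZS_step: "kkt (Z (Suc k)) (S (Suc k)) (Y (Suc k)) (\<theta> k)"
    and Y_step: "Y (Suc k) = Y k + \<rho> k *\<^sub>R (X (Suc k) - Z (Suc k))"
begin

lemma rho_mono: "i \<le> j \<Longrightarrow> \<rho> i \<le> \<rho> j"
  using rho_Suc by (rule lift_Suc_mono_le)

lemma rho_pos: "0 < \<rho> k"
  using rho_0 rho_mono[of 0 k] by simp

lemma supports_iterate: "supports (Z (Suc k)) (S (Suc k)) (Y (Suc k))"
  using ZS_step by (rule kkt_supports)

lemma norm_Y_Suc: "norm (Y (Suc k)) \<le> b"
proof -
  have "subgradient g (S (Suc k)) (- Y (Suc k))"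
    using ZS_step[of k] unfolding kkt_def by blast
  from subgradient_g_norm_le[OF this] show ?thesis
    by simp
qed

text \<open>
  The Lyapunov function.  The multiplier error is weighted with the current penalty, so that
  increasing the penalty can only decrease the energy.
\<close>
definition energy :: "'a \<Rightarrow> 'a \<Rightarrow> nat \<Rightarrow> real" where
  "energy x y k = (norm (Z k - x))\<^sup>2 + (norm (Y k - y))\<^sup>2 / (\<rho> k)\<^sup>2"

text \<open>
  The sum of two monotonicity expressions, for \<open>f\<close> and for the minimal value function of
  the constrained step, each nonnegative against a saddle point.  It measures how far the iterate is
  from optimal.
\<close>
definition gap :: "'a \<Rightarrow> 'a \<Rightarrow> nat \<Rightarrow> real" where
  "gap x y k = (Y (Suc k) - y) \<bullet> (Z (Suc k) - x)
     - (Y k + \<rho> k *\<^sub>R (X (Suc k) - Z k) - y) \<bullet> (X (Suc k) - x)"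

text \<open>
  The pair \<open>(x, y)\<close> is a saddle point of the splitting \<open>f X + h Z\<close> with \<open>X = Z\<close>, where \<open>h\<close> is the
  minimal value function described above; \<open>s\<close> attains \<open>h x\<close>.  Unlike \<open>kkt\<close>, this involves no
  multiplier of the norm constraint and passes to limits.
\<close>
definition certificate :: "'a \<Rightarrow> 'a \<Rightarrow> 'a \<Rightarrow> bool" where
  "certificate x s y \<longleftrightarrow> subgradient f x (- y) \<and> supports x s y"

lemma energy_nonneg: "0 \<le> energy x y k"
  by (simp add: energy_def)

lemma gap_nonneg:
  assumes "certificate x s y"
  shows "0 \<le> gap x y k"
proof -
  have "0 \<le> (Y (Suc k) - y) \<bullet> (Z (Suc k) - x)"
    using assms by (intro supports_monotone[OF supports_iterate]) (auto simp: certificate_def)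
  moreover have "0 \<le> (- (Y k + \<rho> k *\<^sub>R (X (Suc k) - Z k)) - (- y)) \<bullet> (X (Suc k) - x)"
    using assms by (intro subgradient_monotone[OF X_step]) (auto simp: certificate_def)
  then have "(Y k + \<rho> k *\<^sub>R (X (Suc k) - Z k) - y) \<bullet> (X (Suc k) - x) \<le> 0"
    by (simp only: inner_diff_left inner_minus_left)
  ultimately show ?thesis
    by (simp add: gap_def)
qed

text \<open>
  The restriction to \<open>k \<ge> 1\<close> comes from the cross term \<open>(Y (k + 1) - Y k) \<bullet> (Z (k + 1) - Z k)\<close>: it is
  nonnegative by monotonicity once both multipliers are subgradients, and the initial multiplier is
  arbitrary.
\<close>
lemma energy_descent:
  assumes "1 \<le> k"
  shows "energy x y (Suc k) + ((norm (Z (Suc k) - Z k))\<^sup>2 + (norm (X (Suc k) - Z (Suc k)))\<^sup>2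
      + 2 / \<rho> k * gap x y k) \<le> energy x y k"
proof -
  define p d h u where "p = Z k - x" and "d = Z (Suc k) - Z k" and "h = X (Suc k) - Z (Suc k)"
    and "u = Y k - y"
  have eqs: "Z (Suc k) - x = p + d" "X (Suc k) - x = p + d + h" "Y (Suc k) - y = u + \<rho> k *\<^sub>R h"
    "Y k + \<rho> k *\<^sub>R (X (Suc k) - Z k) - y = u + \<rho> k *\<^sub>R (d + h)"
    by (simp_all add: p_def d_def h_def u_def Y_step)
  obtain j where k: "k = Suc j"
    using assms by (cases k) auto
  have "0 \<le> (Y (Suc k) - Y k) \<bullet> (Z (Suc k) - Z k)"
    unfolding k by (rule supports_monotone[OF supports_iterate supports_iterate])
  then have "0 \<le> h \<bullet> d"
    using rho_pos[of k] by (simp add: Y_step h_def d_def zero_le_mult_iff)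
  have "(norm (u + \<rho> k *\<^sub>R h))\<^sup>2 / (\<rho> (Suc k))\<^sup>2 \<le> (norm (u + \<rho> k *\<^sub>R h))\<^sup>2 / (\<rho> k)\<^sup>2"
    using rho_pos[of k] rho_Suc[of k] by (intro divide_left_mono power_mono mult_pos_pos) auto
  then show ?thesis
    using admm_energy_identity[OF rho_pos[of k], of p d u h] \<open>0 \<le> h \<bullet> d\<close>
    unfolding energy_def gap_def eqs by (simp add: p_def[symmetric] d_def[symmetric] h_def[symmetric] u_def[symmetric])
qed

lemma
  assumes cert: "certificate x s y"
  shows decseq_energy: "decseq (\<lambda>k. energy x y (Suc k))"
    and dual_steps_tendsto: "(\<lambda>k. Z (Suc k) - Z k) \<longlonglongrightarrow> 0"
    and primal_residual_tendsto: "(\<lambda>k. X k - Z k) \<longlonglongrightarrow> 0"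
    and summable_gap: "summable (\<lambda>k. 1 / \<rho> k * gap x y k)"
proof -
  define u where "u k = (norm (Z (Suc k) - Z k))\<^sup>2 + (norm (X (Suc k) - Z (Suc k)))\<^sup>2
      + 2 / \<rho> k * gap x y k" for k
  have gap0: "0 \<le> 2 / \<rho> k * gap x y k" for k
    using gap_nonneg[OF cert, of k] rho_pos[of k] by simp
  have u0: "0 \<le> u k" for k
    using gap0[of k] by (simp add: u_def)
  have descent: "energy x y (Suc (Suc k)) + u (Suc k) \<le> energy x y (Suc k)" for k
    unfolding u_def by (rule energy_descent) simp
  then show "decseq (\<lambda>k. energy x y (Suc k))"
    using u0 by (intro decseq_SucI) (smt (verit))
  have "summable (\<lambda>k. u (Suc k))"
    using descent energy_nonneg u0
    by (rule summable_of_telescoping_descent[where V = "\<lambda>k. energy x y (Suc k)"])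
  then have u: "summable u"
    by (simp add: summable_Suc_iff)
  have "(\<lambda>k. (norm (Z (Suc k) - Z k))\<^sup>2) \<longlonglongrightarrow> 0"
    using gap0 by (intro tendsto_sandwich[OF _ _ tendsto_const summable_LIMSEQ_zero[OF u]])
      (auto simp: u_def)
  then show "(\<lambda>k. Z (Suc k) - Z k) \<longlonglongrightarrow> 0"
    by (simp add: tendsto_norm_zero_iff)
  have "(\<lambda>k. (norm (X (Suc k) - Z (Suc k)))\<^sup>2) \<longlonglongrightarrow> 0"
    using gap0 by (intro tendsto_sandwich[OF _ _ tendsto_const summable_LIMSEQ_zero[OF u]])
      (auto simp: u_def)
  then have "(\<lambda>k. X (Suc k) - Z (Suc k)) \<longlonglongrightarrow> 0"
    by (simp add: tendsto_norm_zero_iff)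
  then show "(\<lambda>k. X k - Z k) \<longlonglongrightarrow> 0"
    by (rule LIMSEQ_imp_Suc)
  have dominated: "norm (1 / \<rho> k * gap x y k) \<le> u k" for k
  proof -
    have "0 \<le> gap x y k / \<rho> k"
      using gap_nonneg[OF cert, of k] rho_pos[of k] by simp
    then have "norm (1 / \<rho> k * gap x y k) \<le> 2 * (gap x y k / \<rho> k)"
      by simp
    also have "\<dots> \<le> u k"
      by (simp add: u_def)
    finally show ?thesis .
  qed
  show "summable (\<lambda>k. 1 / \<rho> k * gap x y k)"
    by (rule summable_comparison_test'[OF u dominated])
qed

lemma bounded_iterates:
  "bounded (range (\<lambda>k. Z (Suc k)))" "bounded (range (\<lambda>k. S (Suc k)))"
  "bounded (range (\<lambda>k. Y (Suc k)))"
proof -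
  obtain x s where "optimal x s"
    by (rule optimal_exists)
  then obtain y t where "kkt x s y t" "subgradient f x (- y)"
    by (rule optimal_multiplier)
  then have cert: "certificate x s y"
    by (simp add: certificate_def kkt_supports)
  have Z: "norm (Z (Suc k)) \<le> norm x + sqrt (energy x y 1)" for k
  proof -
    have "(norm (Z (Suc k) - x))\<^sup>2 \<le> energy x y (Suc k)"
      by (simp add: energy_def)
    also have "\<dots> \<le> energy x y 1"
      using decseqD[OF decseq_energy[OF cert], of 0 k] by simp
    finally have "norm (Z (Suc k) - x) \<le> sqrt (energy x y 1)"
      by (rule real_le_rsqrt)
    then show ?thesis
      using norm_triangle_sub[of "Z (Suc k)" x] by simp
  qed
  then show "bounded (range (\<lambda>k. Z (Suc k)))"
    by (intro boundedI) auto
  have "norm (S (Suc k)) \<le> \<delta> + norm D + (norm x + sqrt (energy x y 1))" for k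
  proof -
    have "norm (Z (Suc k) + S (Suc k) - D) \<le> \<delta>"
      using ZS_step[of k] by (simp add: kkt_def feasible_def)
    moreover have "norm (S (Suc k)) \<le> norm (Z (Suc k) + S (Suc k) - D) + norm D + norm (Z (Suc k))"
      using norm_triangle_ineq4[of "Z (Suc k) + S (Suc k)" "Z (Suc k)"]
        norm_triangle_ineq[of "Z (Suc k) + S (Suc k) - D" D] by simp
    ultimately show ?thesis
      using Z[of k] by linarith
  qed
  then show "bounded (range (\<lambda>k. S (Suc k)))"
    by (intro boundedI) auto
  show "bounded (range (\<lambda>k. Y (Suc k)))"
    using norm_Y_Suc by (intro boundedI) auto
qed

lemma feasible_limit:
  assumes "(\<lambda>n. Z (Suc (q n))) \<longlonglongrightarrow> z" and "(\<lambda>n. S (Suc (q n))) \<longlonglongrightarrow> \<sigma>"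
  shows "feasible z \<sigma>"
  unfolding feasible_def
proof (rule LIMSEQ_le_const2)
  show "(\<lambda>n. norm (Z (Suc (q n)) + S (Suc (q n)) - D)) \<longlonglongrightarrow> norm (z + \<sigma> - D)"
    by (intro tendsto_intros assms)
  show "\<exists>N. \<forall>n\<ge>N. norm (Z (Suc (q n)) + S (Suc (q n)) - D) \<le> \<delta>"
    using ZS_step by (auto simp: kkt_def feasible_def)
qed

lemma tendsto_f: "u \<longlonglongrightarrow> x \<Longrightarrow> (\<lambda>n. f (u n)) \<longlonglongrightarrow> f x"
  and tendsto_g: "u \<longlonglongrightarrow> x \<Longrightarrow> (\<lambda>n. g (u n)) \<longlonglongrightarrow> g x"
  by (auto intro: continuous_on_tendsto_compose[OF continuous_f]
      continuous_on_tendsto_compose[OF continuous_g])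

lemma supports_limit:
  assumes Z: "(\<lambda>n. Z (Suc (q n))) \<longlonglongrightarrow> z" and S: "(\<lambda>n. S (Suc (q n))) \<longlonglongrightarrow> \<sigma>"
    and Y: "(\<lambda>n. Y (Suc (q n))) \<longlonglongrightarrow> \<eta>"
  shows "supports z \<sigma> \<eta>"
  unfolding supports_def
proof (intro conjI allI impI)
  show "feasible z \<sigma>"
    using Z S by (rule feasible_limit)
  fix Z' S' assume "feasible Z' S'"
  show "g \<sigma> + \<eta> \<bullet> (Z' - z) \<le> g S'"
  proof (rule LIMSEQ_le_const2)
    show "(\<lambda>n. g (S (Suc (q n))) + Y (Suc (q n)) \<bullet> (Z' - Z (Suc (q n)))) \<longlonglongrightarrow> g \<sigma> + \<eta> \<bullet> (Z' - z)"
      by (intro tendsto_intros tendsto_g Z S Y)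
    show "\<exists>N. \<forall>n\<ge>N. g (S (Suc (q n))) + Y (Suc (q n)) \<bullet> (Z' - Z (Suc (q n))) \<le> g S'"
      using supports_iterate \<open>feasible Z' S'\<close> by (auto simp: supports_def)
  qed
qed

text \<open>
  Up to its residual \<open>X - Z\<close>, an iterate is suboptimal by at most the gap.  The estimate contains no
  multiplier of the iteration, so it can be passed to the limit along any subsequence on
  which the gap vanishes.
\<close>
lemma objective_le_gap:
  assumes "feasible x s"
  shows "f (X (Suc k)) + g (S (Suc k)) + y \<bullet> (X (Suc k) - Z (Suc k)) - gap x y k \<le> f x + g s"
proof -
  have "g (S (Suc k)) + Y (Suc k) \<bullet> (x - Z (Suc k)) \<le> g s"
    using supports_iterate[of k] assms by (simp add: supports_def)
  with subgradientD[OF X_step[of k], of x] show ?thesis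
    unfolding gap_def by (simp add: inner_diff_left inner_diff_right inner_add_left)
qed

text \<open>
  The gap is summable with weights \<open>1 / \<rho> k\<close>.  As these weights have an infinite sum, the gap
  vanishes along a subsequence, and a limit point of that subsequence is optimal.  It remains to find
  a multiplier for which the energy at this limit point vanishes along the subsequence.  If the
  penalties are bounded, the intermediate and the updated multipliers have the same limit, and this
  common limit is such a multiplier.  If the penalties are unbounded, the multiplier error in the energy
  is divided by a sequence tending to infinity, and any multiplier of the limit point will do.
\<close>
theorem converges_to_optimum:
  assumes div: "filterlim (\<lambda>N. \<Sum>k=1..N. 1 / \<rho> k) at_top sequentially"
  obtains x s where "Z \<longlonglongrightarrow> x" "X \<longlonglongrightarrow> x" "S \<longlonglongrightarrow> s" "optimal x s"
proof -
  obtain x s where opt: "optimal x s"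
    by (rule optimal_exists)
  then obtain y t where y: "kkt x s y t" "subgradient f x (- y)"
    by (rule optimal_multiplier)
  then have cert: "certificate x s y"
    by (simp add: certificate_def kkt_supports)
  have XZ: "(\<lambda>k. X (Suc k) - Z (Suc k)) \<longlonglongrightarrow> 0"
    using primal_residual_tendsto[OF cert] by (rule LIMSEQ_Suc)
  have weights: "0 \<le> 1 / \<rho> k" for k
    using rho_pos[of k] by simp
  obtain r where r: "strict_mono r" "(\<lambda>n. gap x y (r n)) \<longlonglongrightarrow> 0"
    using null_subsequence_of_weighted_sum[OF div weights gap_nonneg[OF cert] summable_gap[OF cert]]
    by blast
  have "bounded (range (\<lambda>n. (Z (Suc (r n)), S (Suc (r n)), Y (Suc (r n)))))"
    by (rule bounded_subset[OF bounded_Times[OF bounded_iterates(1) bounded_Times[OF bounded_iterates(2,3)]]])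
      auto
  then obtain l q where q: "strict_mono q"
    and l: "((\<lambda>n. (Z (Suc (r n)), S (Suc (r n)), Y (Suc (r n)))) \<circ> q) \<longlonglongrightarrow> l"
    using bounded_imp_convergent_subsequence by blast
  define p where "p = r \<circ> q"
  have p: "strict_mono p"
    unfolding p_def using r(1) q by (rule strict_mono_o)
  obtain z \<sigma> \<eta> where "l = (z, \<sigma>, \<eta>)"
    by (cases l)
  with l have lim: "(\<lambda>n. (Z (Suc (p n)), S (Suc (p n)), Y (Suc (p n)))) \<longlonglongrightarrow> (z, \<sigma>, \<eta>)"
    by (simp add: p_def comp_def)
  have Zp: "(\<lambda>n. Z (Suc (p n))) \<longlonglongrightarrow> z" and Sp: "(\<lambda>n. S (Suc (p n))) \<longlonglongrightarrow> \<sigma>"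
    and Yp: "(\<lambda>n. Y (Suc (p n))) \<longlonglongrightarrow> \<eta>"
    using tendsto_fst[OF lim] tendsto_fst[OF tendsto_snd[OF lim]] tendsto_snd[OF tendsto_snd[OF lim]]
    by simp_all
  have XZp: "(\<lambda>n. X (Suc (p n)) - Z (Suc (p n))) \<longlonglongrightarrow> 0"
    using LIMSEQ_subseq_LIMSEQ[OF XZ p] by (simp add: comp_def)
  have Xp: "(\<lambda>n. X (Suc (p n))) \<longlonglongrightarrow> z"
    using tendsto_add[OF XZp Zp] by simp
  have gap_p: "(\<lambda>n. gap x y (p n)) \<longlonglongrightarrow> 0"
    using LIMSEQ_subseq_LIMSEQ[OF r(2) q] by (simp add: p_def comp_def)

  \<comment> \<open>passing to the limit in \<open>objective_le_gap\<close>\<close>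
  have "f z + g \<sigma> + y \<bullet> 0 - 0 \<le> f x + g s"
  proof (rule LIMSEQ_le_const2)
    show "(\<lambda>n. f (X (Suc (p n))) + g (S (Suc (p n))) + y \<bullet> (X (Suc (p n)) - Z (Suc (p n))) - gap x y (p n))
        \<longlonglongrightarrow> f z + g \<sigma> + y \<bullet> 0 - 0"
      by (intro tendsto_intros tendsto_f tendsto_g Xp Sp XZp gap_p)
  qed (use objective_le_gap opt in \<open>auto simp: optimal_def\<close>)
  then have opt': "optimal z \<sigma>"
    using opt feasible_limit[OF Zp Sp] by (force simp: optimal_def)

  obtain y' where cert': "certificate z \<sigma> y'" and energy_p: "(\<lambda>n. energy z y' (Suc (p n))) \<longlonglongrightarrow> 0"
  proof (cases "\<exists>R. \<forall>k. \<rho> k \<le> R")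
    case True
    then obtain R where R: "\<And>k. \<rho> k \<le> R"
      by blast
    \<comment> \<open>the difference of the updated and the intermediate multiplier\<close>
    have step: "(\<lambda>n. \<rho> (p n) *\<^sub>R (Z (Suc (p n)) - Z (p n))) \<longlonglongrightarrow> 0"
    proof (rule Lim_null_comparison)
      show "\<forall>\<^sub>F n in sequentially. norm (\<rho> (p n) *\<^sub>R (Z (Suc (p n)) - Z (p n)))
          \<le> R * norm (Z (Suc (p n)) - Z (p n))"
        using R rho_pos by (auto intro!: always_eventually mult_right_mono simp: less_imp_le abs_of_pos)
      have "(\<lambda>n. Z (Suc (p n)) - Z (p n)) \<longlonglongrightarrow> 0"
        using LIMSEQ_subseq_LIMSEQ[OF dual_steps_tendsto[OF cert] p] by (simp add: comp_def)
      then show "(\<lambda>n. R * norm (Z (Suc (p n)) - Z (p n))) \<longlonglongrightarrow> 0"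
        by (intro tendsto_mult_right_zero tendsto_norm_zero)
    qed
    have "Y k + \<rho> k *\<^sub>R (X (Suc k) - Z k) = Y (Suc k) + \<rho> k *\<^sub>R (Z (Suc k) - Z k)" for k
      by (simp add: Y_step algebra_simps)
    then have Yhat: "(\<lambda>n. Y (p n) + \<rho> (p n) *\<^sub>R (X (Suc (p n)) - Z (p n))) \<longlonglongrightarrow> \<eta>"
      using tendsto_add[OF Yp step] by simp
    have "subgradient f z (- \<eta>)"
      unfolding subgradient_def
    proof
      fix v
      show "f z + - \<eta> \<bullet> (v - z) \<le> f v"
      proof (rule LIMSEQ_le_const2)
        show "(\<lambda>n. f (X (Suc (p n))) + - (Y (p n) + \<rho> (p n) *\<^sub>R (X (Suc (p n)) - Z (p n))) \<bullet> (v - X (Suc (p n))))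
          \<longlonglongrightarrow> f z + - \<eta> \<bullet> (v - z)"
          by (intro tendsto_intros tendsto_f Xp Yhat)
      qed (use subgradientD[OF X_step] in auto)
    qed
    moreover have "(\<lambda>n. energy z \<eta> (Suc (p n))) \<longlonglongrightarrow> 0"
    proof (rule tendsto_sandwich[OF _ _ tendsto_const])
      show "(\<lambda>n. (norm (Z (Suc (p n)) - z))\<^sup>2 + (norm (Y (Suc (p n)) - \<eta>))\<^sup>2 / (\<rho> 0)\<^sup>2) \<longlonglongrightarrow> 0"
        using Zp Yp by (auto intro!: tendsto_eq_intros simp: rho_0[THEN less_imp_neq, symmetric])
      show "\<forall>\<^sub>F n in sequentially. energy z \<eta> (Suc (p n))
          \<le> (norm (Z (Suc (p n)) - z))\<^sup>2 + (norm (Y (Suc (p n)) - \<eta>))\<^sup>2 / (\<rho> 0)\<^sup>2"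
      proof (intro always_eventually allI)
        fix n
        show "energy z \<eta> (Suc (p n))
          \<le> (norm (Z (Suc (p n)) - z))\<^sup>2 + (norm (Y (Suc (p n)) - \<eta>))\<^sup>2 / (\<rho> 0)\<^sup>2"
          unfolding energy_def using rho_0 rho_pos[of "Suc (p n)"] rho_mono[of 0 "Suc (p n)"]
          by (intro add_left_mono divide_left_mono power_mono mult_pos_pos zero_less_power) auto
      qed
    qed (simp add: energy_nonneg)
    ultimately show ?thesis
      using that supports_limit[OF Zp Sp Yp] by (simp add: certificate_def)
  next
    case False
    obtain y' t' where "kkt z \<sigma> y' t'" "subgradient f z (- y')"
      using opt' by (rule optimal_multiplier)
    then have "certificate z \<sigma> y'"
      by (simp add: certificate_def kkt_supports)
    moreover have "(\<lambda>n. energy z y' (Suc (p n))) \<longlonglongrightarrow> 0"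
    proof (rule tendsto_sandwich[OF _ _ tendsto_const])
      have "filterlim \<rho> at_top sequentially"
        unfolding filterlim_at_top eventually_sequentially
        using False rho_mono by (meson le_cases order_trans)
      moreover have "strict_mono (\<lambda>n. Suc (p n))"
        using p by (simp add: strict_mono_def)
      ultimately have "filterlim (\<lambda>n. \<rho> (Suc (p n))) at_top sequentially"
        by (rule filterlim_compose[OF _ filterlim_subseq])
      then have inv: "(\<lambda>n. inverse (\<rho> (Suc (p n)))) \<longlonglongrightarrow> 0"
        by (rule tendsto_inverse_0_at_top)
      show "(\<lambda>n. (norm (Z (Suc (p n)) - z))\<^sup>2 + (b + norm y')\<^sup>2 * (inverse (\<rho> (Suc (p n))))\<^sup>2) \<longlonglongrightarrow> 0"
        using tendsto_add[OF tendsto_power[OF tendsto_norm[OF LIM_zero[OF Zp]], of 2]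
            tendsto_mult_left[OF tendsto_power[OF inv, of 2]]] by simp
      have "energy z y' (Suc k) \<le> (norm (Z (Suc k) - z))\<^sup>2 + (b + norm y')\<^sup>2 * (inverse (\<rho> (Suc k)))\<^sup>2" for k
      proof -
        have "norm (Y (Suc k) - y') \<le> b + norm y'"
          using norm_triangle_ineq4[of "Y (Suc k)" y'] norm_Y_Suc[of k] by simp
        then have "(norm (Y (Suc k) - y'))\<^sup>2 * (inverse (\<rho> (Suc k)))\<^sup>2 \<le> (b + norm y')\<^sup>2 * (inverse (\<rho> (Suc k)))\<^sup>2"
          by (intro mult_right_mono power_mono) auto
        then show ?thesis
          by (simp add: energy_def divide_inverse power_inverse)
      qed
      then show "\<forall>\<^sub>F n in sequentially. energy z y' (Suc (p n))
          \<le> (norm (Z (Suc (p n)) - z))\<^sup>2 + (b + norm y')\<^sup>2 * (inverse (\<rho> (Suc (p n))))\<^sup>2"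
        by (intro always_eventually allI)
    qed (simp add: energy_nonneg)
    ultimately show ?thesis
      by (rule that)
  qed
  have energy0: "(\<lambda>k. energy z y' (Suc k)) \<longlonglongrightarrow> 0"
    using decseq_tendsto_of_subseq[OF decseq_energy[OF cert'] energy_nonneg p energy_p] .
  have "(\<lambda>k. (norm (Z (Suc k) - z))\<^sup>2) \<longlonglongrightarrow> 0"
    by (rule tendsto_sandwich[OF _ _ tendsto_const energy0]) (auto simp: energy_def)
  then have Z_Suc: "(\<lambda>k. Z (Suc k)) \<longlonglongrightarrow> z"
    by (simp add: tendsto_norm_zero_iff LIM_zero_iff)
  then have Z: "Z \<longlonglongrightarrow> z"
    by (rule LIMSEQ_imp_Suc)
  moreover have "X \<longlonglongrightarrow> z"
    using tendsto_add[OF primal_residual_tendsto[OF cert] Z] by simp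
  moreover have "(\<lambda>k. S (Suc k)) \<longlonglongrightarrow> \<sigma>"
  proof (rule bounded_unique_limit_point_tendsto[OF bounded_iterates(2)])
    fix j :: "nat \<Rightarrow> nat" and \<sigma>' assume j: "strict_mono j" and S: "(\<lambda>n. S (Suc (j n))) \<longlonglongrightarrow> \<sigma>'"
    have Zj: "(\<lambda>n. Z (Suc (j n))) \<longlonglongrightarrow> z"
      using LIMSEQ_subseq_LIMSEQ[OF Z_Suc j] by (simp add: comp_def)
    have YZ: "(\<lambda>n. Y (Suc (j n)) \<bullet> (z - Z (Suc (j n)))) \<longlonglongrightarrow> 0"
    proof (rule Lim_null_comparison)
      show "\<forall>\<^sub>F n in sequentially. norm (Y (Suc (j n)) \<bullet> (z - Z (Suc (j n)))) \<le> b * norm (z - Z (Suc (j n)))"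
        using norm_Y_Suc
        by (intro always_eventually allI) (smt (verit) Cauchy_Schwarz_ineq2 mult_right_mono norm_ge_zero real_norm_def)
      show "(\<lambda>n. b * norm (z - Z (Suc (j n)))) \<longlonglongrightarrow> 0"
        using Zj by (auto intro!: tendsto_eq_intros)
    qed
    \<comment> \<open>the iterate \<open>S\<close> beats the competitor \<open>(z, \<sigma>)\<close> up to a term that vanishes in the limit\<close>
    have "g \<sigma>' + 0 \<le> g \<sigma>"
    proof (rule LIMSEQ_le_const2)
      show "(\<lambda>n. g (S (Suc (j n))) + Y (Suc (j n)) \<bullet> (z - Z (Suc (j n)))) \<longlonglongrightarrow> g \<sigma>' + 0"
        by (intro tendsto_add tendsto_g S YZ)
    qed (use supports_iterate opt' in \<open>auto simp: supports_def optimal_def\<close>)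
    moreover have "g \<sigma> \<le> g S'" if "feasible z S'" for S'
      using opt' that by (force simp: optimal_def)
    ultimately show "\<sigma>' = \<sigma>"
      using least_g_unique[of z \<sigma> \<sigma>'] opt' feasible_limit[OF Zj S] by (simp add: optimal_def)
  qed
  then have "S \<longlonglongrightarrow> \<sigma>"
    by (rule LIMSEQ_imp_Suc)
  ultimately show ?thesis
    using opt' that by blast
qed

end

section \<open>Saddle points and convergence of the multipliers\<close>

context stable_decomposition
begin

definition lagrangian :: "'a \<Rightarrow> 'a \<Rightarrow> 'a \<Rightarrow> 'a \<Rightarrow> real \<Rightarrow> real" where
  "lagrangian X Z S Y \<theta> = f X + g S + Y \<bullet> (X - Z) + \<theta> / 2 * ((norm (Z + S - D))\<^sup>2 - \<delta>\<^sup>2)"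

text \<open>
  The first inequality is complementary slackness.  The second adds the subgradient inequalities for
  \<open>f\<close> and \<open>g\<close> to the one for the convex penalty term, whose gradient is \<open>y\<close>; the pairings with \<open>y\<close> cancel.
\<close>
lemma kkt_saddle_point:
  assumes kkt: "kkt x s y t" and sub: "subgradient f x (- y)"
  shows "0 \<le> \<theta> \<Longrightarrow> lagrangian x x s Y \<theta> \<le> lagrangian x x s y t"
    and "lagrangian x x s y t \<le> lagrangian X Z S y t"
proof -
  have t: "0 \<le> t" and y: "y = t *\<^sub>R (x + s - D)" and gs: "subgradient g s (- y)"
    using kkt unfolding kkt_def by blast+
  have comp: "t / 2 * ((norm (x + s - D))\<^sup>2 - \<delta>\<^sup>2) = 0"
    using kkt by (simp add: kkt_def)
  have feas: "(norm (x + s - D))\<^sup>2 \<le> \<delta>\<^sup>2"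
    using kkt by (auto simp: kkt_def feasible_def power_mono)
  show "lagrangian x x s Y \<theta> \<le> lagrangian x x s y t" if "0 \<le> \<theta>"
  proof -
    have "\<theta> / 2 * ((norm (x + s - D))\<^sup>2 - \<delta>\<^sup>2) \<le> 0"
      using that feas by (intro mult_nonneg_nonpos) auto
    with comp show ?thesis
      unfolding lagrangian_def diff_self inner_zero_right by linarith
  qed
  have shift: "Z + S - D = (x + s - D) + ((Z - x) + (S - s))"
    by simp
  have "t / 2 * (norm (x + s - D))\<^sup>2 + y \<bullet> ((Z - x) + (S - s)) \<le> t / 2 * (norm (Z + S - D))\<^sup>2"
    using half_norm_square_shift[OF shift, of t] t unfolding y by simp
  then show "lagrangian x x s y t \<le> lagrangian X Z S y t"
    using subgradientD[OF sub, of X] subgradientD[OF gs, of S]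
    unfolding lagrangian_def right_diff_distrib
    by (simp add: inner_diff_right inner_add_right)
qed

text \<open>
  When \<open>x\<close> alone is within distance \<open>\<delta>\<close> of \<open>D\<close>, the choice \<open>s = 0\<close> is feasible and costs nothing.
\<close>
lemma optimal_sparse_part_zero:
  assumes "optimal x s" and "norm (D - x) \<le> \<delta>"
  shows "s = 0"
proof (rule ccontr)
  assume "s \<noteq> 0"
  have "feasible x 0"
    using assms(2) by (simp add: feasible_def norm_minus_commute)
  then have "g s \<le> 0"
    using assms(1) by (force simp: optimal_def g_zero)
  with g_pos[OF \<open>s \<noteq> 0\<close>] show False
    by simp
qed

text \<open>
  Pairing the stationarity condition \<open>- \<theta> (z + s - D) \<in> \<partial>g s\<close> with \<open>s\<close> gives an explicit formula for
  the scalar multiplier whenever \<open>s\<close> is nonzero.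
\<close>
lemma kkt_euler:
  assumes "kkt z s y t"
  shows "t * ((D - z - s) \<bullet> s) = g s"
proof -
  have "subgradient g s (- y)" "y = t *\<^sub>R (z + s - D)"
    using assms unfolding kkt_def by blast+
  then have "- (t *\<^sub>R (z + s - D)) \<bullet> s = g s"
    using subgradient_g_euler by blast
  then show ?thesis
    by (simp add: inner_diff_left inner_add_left algebra_simps)
qed

end

context nsa_iteration
begin

text \<open>
  If \<open>|D - x| < \<delta>\<close>, then the limit \<open>s\<close> is zero, the constraint is eventually inactive, and the multipliers
  vanish from some index on.  If \<open>|D - x| > \<delta>\<close>, then \<open>s\<close> is nonzero, and Euler's identity writes
  \<open>\<theta> k\<close> as a quotient of continuous functions of the iterates with nonzero limiting denominator.
  In both cases \<open>Y\<close> follows from \<open>\<theta>\<close>.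
\<close>
lemma multipliers_converge:
  assumes Z: "Z \<longlonglongrightarrow> x" and S: "S \<longlonglongrightarrow> s" and kkt: "kkt x s y t" and opt: "optimal x s"
    and ne: "norm (D - x) \<noteq> \<delta>"
  shows "\<theta> \<longlonglongrightarrow> t" and "Y \<longlonglongrightarrow> y"
proof -
  have Z': "(\<lambda>k. Z (Suc k)) \<longlonglongrightarrow> x" and S': "(\<lambda>k. S (Suc k)) \<longlonglongrightarrow> s"
    using Z S by (auto intro: LIMSEQ_Suc)
  have res: "(\<lambda>k. Z (Suc k) + S (Suc k) - D) \<longlonglongrightarrow> x + s - D"
    by (intro tendsto_intros Z' S')
  show \<theta>: "\<theta> \<longlonglongrightarrow> t"
  proof (cases "norm (D - x) < \<delta>")
    case True
    then have "s = 0"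
      using optimal_sparse_part_zero[OF opt] by simp
    then have less: "norm (x + s - D) < \<delta>"
      using True by (simp add: norm_minus_commute)
    have zero: "\<tau> = 0" if "kkt z' s' y' \<tau>" "norm (z' + s' - D) < \<delta>" for z' s' y' \<tau>
      using that \<delta>_pos power_strict_mono[of "norm (z' + s' - D)" \<delta> 2] by (auto simp: kkt_def)
    have "eventually (\<lambda>k. norm (Z (Suc k) + S (Suc k) - D) < \<delta>) sequentially"
      using tendsto_norm[OF res] less by (rule order_tendstoD(2))
    then have "eventually (\<lambda>k. \<theta> k = t) sequentially"
      using zero[OF kkt less] zero[OF ZS_step] by (auto elim: eventually_mono)
    then show ?thesis
      by (rule tendsto_eventually)
  next
    case False
    have "s \<noteq> 0"
      using False ne kkt by (auto simp: kkt_def feasible_def norm_minus_commute)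
    then have c: "(D - x - s) \<bullet> s \<noteq> 0"
      using kkt_euler[OF kkt] g_pos by force
    have lim: "(\<lambda>k. (D - Z (Suc k) - S (Suc k)) \<bullet> S (Suc k)) \<longlonglongrightarrow> (D - x - s) \<bullet> s"
      by (intro tendsto_intros Z' S')
    then have "(\<lambda>k. g (S (Suc k)) / ((D - Z (Suc k) - S (Suc k)) \<bullet> S (Suc k))) \<longlonglongrightarrow> g s / ((D - x - s) \<bullet> s)"
      by (intro tendsto_divide tendsto_g S' c)
    moreover have "g s / ((D - x - s) \<bullet> s) = t"
      using kkt_euler[OF kkt] c by (simp add: field_simps)
    moreover have "eventually (\<lambda>k. g (S (Suc k)) / ((D - Z (Suc k) - S (Suc k)) \<bullet> S (Suc k)) = \<theta> k) sequentially"
      using tendsto_imp_eventually_ne[OF lim c]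
      by (rule eventually_mono) (simp add: kkt_euler[OF ZS_step, symmetric])
    ultimately show ?thesis
      using Lim_transform_eventually by fastforce
  qed
  have Y_eq: "Y (Suc k) = \<theta> k *\<^sub>R (Z (Suc k) + S (Suc k) - D)" for k
    using ZS_step[of k] unfolding kkt_def by blast
  have y_eq: "y = t *\<^sub>R (x + s - D)"
    using kkt unfolding kkt_def by blast
  have "(\<lambda>k. Y (Suc k)) \<longlonglongrightarrow> y"
    unfolding Y_eq y_eq by (intro tendsto_scaleR \<theta> res)
  then show "Y \<longlonglongrightarrow> y"
    by (rule LIMSEQ_imp_Suc)
qed

lemma theta_nonneg: "0 \<le> \<theta> k"
  using ZS_step[of k] unfolding kkt_def by blast

lemma theta_le: "\<theta> k \<le> b / \<delta>"
proof -
  have Y: "norm (Y (Suc k)) = \<theta> k * norm (Z (Suc k) + S (Suc k) - D)"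
    and comp: "\<theta> k = 0 \<or> (norm (Z (Suc k) + S (Suc k) - D))\<^sup>2 = \<delta>\<^sup>2"
    using ZS_step[of k] by (auto simp: kkt_def)
  have "\<theta> k * \<delta> \<le> b"
    using comp
  proof
    assume "\<theta> k = 0"
    then show ?thesis
      using norm_Y_Suc[of k] Y by simp
  next
    assume "(norm (Z (Suc k) + S (Suc k) - D))\<^sup>2 = \<delta>\<^sup>2"
    then have "norm (Z (Suc k) + S (Suc k) - D) = \<delta>"
      using \<delta>_pos by (simp add: power2_eq_iff_nonneg)
    then show ?thesis
      using norm_Y_Suc[of k] Y by simp
  qed
  then show ?thesis
    using \<delta>_pos by (simp add: pos_le_divide_eq)
qed

text \<open>
  The multipliers \<open>Y\<close> are, up to sign, subgradients of \<open>g\<close> and hence bounded.  Where \<open>\<theta>\<close> is nonzero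
  the constraint is active, so \<open>|Y| = \<theta> \<delta>\<close> bounds \<open>\<theta>\<close> as well.
\<close>
lemma multipliers_limit_point:
  obtains r y t where "strict_mono r" "(\<lambda>k. (Y (r k), \<theta> (r k))) \<longlonglongrightarrow> (y, t)" "0 \<le> t"
proof -
  have "norm (Y k) \<le> norm (Y 0) + b" for k
  proof (cases k)
    case 0
    then show ?thesis
      using order_trans[OF norm_ge_zero norm_Y_Suc[of 0]] by simp
  next
    case (Suc j)
    show ?thesis
      unfolding Suc using norm_Y_Suc[of j] norm_ge_zero[of "Y 0"] by linarith
  qed
  then have "bounded (range Y)"
    by (intro boundedI) auto
  moreover have "bounded (range \<theta>)"
    using theta_nonneg theta_le by (intro boundedI[of _ "b / \<delta>"]) auto
  ultimately have "bounded (range (\<lambda>k. (Y k, \<theta> k)))"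
    by (rule bounded_subset[OF bounded_Times]) auto
  then obtain l r where r: "strict_mono r" "((\<lambda>k. (Y k, \<theta> k)) \<circ> r) \<longlonglongrightarrow> l"
    using bounded_imp_convergent_subsequence by blast
  then have lim: "(\<lambda>k. (Y (r k), \<theta> (r k))) \<longlonglongrightarrow> (fst l, snd l)"
    by (simp add: comp_def)
  have "(\<lambda>k. \<theta> (r k)) \<longlonglongrightarrow> snd l"
    using tendsto_snd[OF lim] by simp
  then have "0 \<le> snd l"
    by (rule LIMSEQ_le_const) (use theta_nonneg in auto)
  with r(1) lim show ?thesis
    by (rule that)
qed

end

section \<open>The nuclear norm and the entrywise norm\<close>

lemma norm_le_entry_l1_norm:
  fixes S :: "real^'n^'m"
  shows "norm S \<le> entry_l1_norm S"
proof -
  have "norm S \<le> (\<Sum>i\<in>UNIV. norm (S $ i))"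
    unfolding norm_vec_def by (rule L2_set_le_sum) simp
  also have "\<dots> \<le> entry_l1_norm S"
    unfolding entry_l1_norm_def by (intro sum_mono norm_le_l1_cart)
  finally show ?thesis .
qed

lemma entry_l1_norm_le_norm:
  fixes S :: "real^'n^'m"
  shows "entry_l1_norm S \<le> real (CARD('m) * CARD('n)) * norm S"
proof -
  have "\<bar>S $ i $ j\<bar> \<le> norm S" for i j
    using component_le_norm_cart[of "S $ i" j] Finite_Cartesian_Product.norm_nth_le[of S i] by linarith
  then have "entry_l1_norm S \<le> (\<Sum>i\<in>(UNIV::'m set). \<Sum>j\<in>(UNIV::'n set). norm S)"
    unfolding entry_l1_norm_def by (intro sum_mono) auto
  then show ?thesis
    by simp
qed

lemma stable_decomposition_SPCP:
  fixes D :: "real^'n^'m"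
  assumes "0 < \<xi>" and "0 < \<delta>"
  shows "stable_decomposition nuclear_norm (\<lambda>S::real^'n^'m. \<xi> * entry_l1_norm S) \<delta> \<xi>
    (\<xi> * real (CARD('m) * CARD('n)))"
proof
  show "convex_on UNIV (nuclear_norm :: real^'n^'m \<Rightarrow> real)"
    by (rule convex_nuclear_norm)
  fix x y :: "real^'n^'m" and t :: real
  show "0 \<le> nuclear_norm x"
    by (rule nuclear_norm_nonneg)
  have "entry_l1_norm (x + y) \<le> entry_l1_norm x + entry_l1_norm y"
    unfolding entry_l1_norm_def sum.distrib[symmetric] by (intro sum_mono) (simp add: abs_triangle_ineq)
  then show "\<xi> * entry_l1_norm (x + y) \<le> \<xi> * entry_l1_norm x + \<xi> * entry_l1_norm y"
    using assms(1) by (simp flip: distrib_left)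
  show "\<xi> * entry_l1_norm (t *\<^sub>R x) = t * (\<xi> * entry_l1_norm x)" if "0 \<le> t"
    using that by (simp add: entry_l1_norm_def abs_mult sum_distrib_left mult_ac)
  show "\<xi> * norm x \<le> \<xi> * entry_l1_norm x"
    using assms(1) norm_le_entry_l1_norm[of x] by simp
  show "\<xi> * entry_l1_norm x \<le> \<xi> * real (CARD('m) * CARD('n)) * norm x"
    using assms(1) entry_l1_norm_le_norm[of x] by (simp add: mult.assoc)
qed (use assms in auto)

text \<open>
  For \<open>\<rho> \<ge> c > 0\<close> the squared inverses are at most \<open>1 / c\<close> times the inverses.
\<close>
lemma filterlim_sum_inverse_of_sum_inverse_square:
  fixes \<rho> :: "nat \<Rightarrow> real"
  assumes "0 < c" and ge: "\<And>k. c \<le> \<rho> k"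
    and div: "filterlim (\<lambda>N. \<Sum>k=1..N. 1 / (\<rho> k)\<^sup>2) at_top sequentially"
  shows "filterlim (\<lambda>N. \<Sum>k=1..N. 1 / \<rho> k) at_top sequentially"
proof (rule filterlim_at_top_mono)
  show "filterlim (\<lambda>N. c * (\<Sum>k=1..N. 1 / (\<rho> k)\<^sup>2)) at_top sequentially"
    using filterlim_tendsto_pos_mult_at_top[OF tendsto_const \<open>0 < c\<close> div] .
  have "c * (1 / (\<rho> k)\<^sup>2) \<le> 1 / \<rho> k" for k
    using ge[of k] \<open>0 < c\<close> by (simp add: power2_eq_square divide_simps)
  then show "\<forall>\<^sub>F N in sequentially. c * (\<Sum>k=1..N. 1 / (\<rho> k)\<^sup>2) \<le> (\<Sum>k=1..N. 1 / \<rho> k)"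
    unfolding sum_distrib_left by (intro always_eventually allI sum_mono)
qed

theorem theorem5p2:
  fixes D :: "real^'n^'m" and \<xi> \<delta> :: real
    and X Yh Z S Y :: "nat \<Rightarrow> real^'n^'m" and \<theta> \<rho> :: "nat \<Rightarrow> real"
  assumes "\<xi> > 0" and "\<delta> > 0"
    and "NSA_run D \<xi> \<delta> X Yh Z S Y \<theta> \<rho>"
  shows
    "(filterlim (\<lambda>N. \<Sum>k=1..N. 1 / \<rho> k) at_top sequentially \<longrightarrow>
        (\<exists>Xs Ss. Z \<longlonglongrightarrow> Xs \<and> X \<longlonglongrightarrow> Xs \<and> S \<longlonglongrightarrow> Ss \<and> SPCP_optimal D \<xi> \<delta> Xs Ss)) \<and>
     (filterlim (\<lambda>N. \<Sum>k=1..N. 1 / (\<rho> k)\<^sup>2) at_top sequentially \<longrightarrow>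
        (\<exists>Xs Ss. X \<longlonglongrightarrow> Xs \<and> S \<longlonglongrightarrow> Ss \<and>
           (norm (D - Xs) \<noteq> \<delta> \<longrightarrow>
              (\<exists>\<theta>s\<ge>0. \<exists>Ys. \<theta> \<longlonglongrightarrow> \<theta>s \<and> Y \<longlonglongrightarrow> Ys \<and> SPCP_saddle_point D \<xi> \<delta> Xs Xs Ss Ys \<theta>s)) \<and>
           (norm (D - Xs) = \<delta> \<longrightarrow>
              (\<exists>Ys \<theta>s. (\<exists>r. strict_mono r \<and> (\<lambda>k. (Y (r k), \<theta> (r k))) \<longlonglongrightarrow> (Ys, \<theta>s)) \<and>
                 is_arg_max (\<lambda>(Y', \<theta>'). SPCP_lagrangian D \<xi> \<delta> Xs Xs Ss Y' \<theta>')
                   (\<lambda>(Y', \<theta>'). 0 \<le> \<theta>') (Ys, \<theta>s)))))"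
proof -
  let ?g = "\<lambda>S::real^'n^'m. \<xi> * entry_l1_norm S"
  interpret stable_decomposition nuclear_norm ?g D \<delta> \<xi> "\<xi> * real (CARD('m) * CARD('n))"
    using assms(1,2) by (rule stable_decomposition_SPCP)
  have \<rho>0: "0 < \<rho> 0" and mono: "\<rho> k \<le> \<rho> (Suc k)"
    and X: "is_arg_min (\<lambda>X. nuclear_norm X + Y k \<bullet> (X - Z k) + \<rho> k / 2 * (norm (X - Z k))\<^sup>2)
      (\<lambda>_. True) (X (Suc k))"
    and ZS: "is_arg_min (\<lambda>(Z, S). ?g S + (- Y k) \<bullet> (Z - X (Suc k)) + \<rho> k / 2 * (norm (Z - X (Suc k)))\<^sup>2)
      (\<lambda>(Z, S). (norm (Z + S - D))\<^sup>2 \<le> \<delta>\<^sup>2) (Z (Suc k), S (Suc k))"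
    and dual: "optimal_dual_variable
      (\<lambda>(Z, S). ?g S + (- Y k) \<bullet> (Z - X (Suc k)) + \<rho> k / 2 * (norm (Z - X (Suc k)))\<^sup>2)
      (\<lambda>(Z, S). 1 / 2 * (norm (Z + S - D))\<^sup>2 - \<delta>\<^sup>2 / 2) (\<theta> k)"
    and Y: "Y (Suc k) = Y k + \<rho> k *\<^sub>R (X (Suc k) - Z (Suc k))" for k
    using assms(3) unfolding NSA_run_def NSA_X_objective_def[abs_def] NSA_ZS_objective_def by blast+
  have \<rho>_ge: "\<rho> 0 \<le> \<rho> k" for k
    using lift_Suc_mono_le[of \<rho> 0 k] mono by simp
  interpret nsa_iteration nuclear_norm ?g D \<delta> \<xi> "\<xi> * real (CARD('m) * CARD('n))" X Z S Y \<theta> \<rho>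
  proof
    fix k
    have "0 < \<rho> k"
      using \<rho>0 \<rho>_ge[of k] by simp
    then show "kkt (Z (Suc k)) (S (Suc k)) (Y (Suc k)) (\<theta> k)"
      unfolding Y by (rule ZS_step_kkt[OF ZS dual])
    show "subgradient nuclear_norm (X (Suc k)) (- (Y k + \<rho> k *\<^sub>R (X (Suc k) - Z k)))"
      by (rule X_step_subgradient[OF X])
  qed (use \<rho>0 mono Y in auto)
  have lagrangian: "SPCP_lagrangian D \<xi> \<delta> = lagrangian"
    by (intro ext) (simp add: SPCP_lagrangian_def lagrangian_def)
  have optimal_iff: "SPCP_optimal D \<xi> \<delta> x s \<longleftrightarrow> optimal x s" for x s
    by (auto simp: SPCP_optimal_def optimal_def feasible_def is_arg_min_linorder)
  show ?thesis
  proof (intro conjI impI)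
    assume "filterlim (\<lambda>N. \<Sum>k=1..N. 1 / \<rho> k) at_top sequentially"
    then show "\<exists>Xs Ss. Z \<longlonglongrightarrow> Xs \<and> X \<longlonglongrightarrow> Xs \<and> S \<longlonglongrightarrow> Ss \<and> SPCP_optimal D \<xi> \<delta> Xs Ss"
      unfolding optimal_iff using converges_to_optimum by metis
  next
    assume "filterlim (\<lambda>N. \<Sum>k=1..N. 1 / (\<rho> k)\<^sup>2) at_top sequentially"
    then have "filterlim (\<lambda>N. \<Sum>k=1..N. 1 / \<rho> k) at_top sequentially"
      by (rule filterlim_sum_inverse_of_sum_inverse_square[OF \<rho>0 \<rho>_ge])
    then obtain x s where lim: "Z \<longlonglongrightarrow> x" "X \<longlonglongrightarrow> x" "S \<longlonglongrightarrow> s" and opt: "optimal x s"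
      by (rule converges_to_optimum)
    obtain y t where kkt: "kkt x s y t" and sub: "subgradient nuclear_norm x (- y)"
      using opt by (rule optimal_multiplier)
    have "\<exists>\<theta>s\<ge>0. \<exists>Ys. \<theta> \<longlonglongrightarrow> \<theta>s \<and> Y \<longlonglongrightarrow> Ys \<and> SPCP_saddle_point D \<xi> \<delta> x x s Ys \<theta>s"
      if "norm (D - x) \<noteq> \<delta>"
    proof (intro exI conjI)
      show "0 \<le> t"
        using kkt by (simp add: kkt_def)
      then show "SPCP_saddle_point D \<xi> \<delta> x x s y t"
        using kkt_saddle_point[OF kkt sub] by (simp add: SPCP_saddle_point_def lagrangian)
      show "\<theta> \<longlonglongrightarrow> t" "Y \<longlonglongrightarrow> y"
        using multipliers_converge[OF lim(1,3) kkt opt that] by blast+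
    qed
    moreover have "\<exists>Ys \<theta>s. (\<exists>r. strict_mono r \<and> (\<lambda>k. (Y (r k), \<theta> (r k))) \<longlonglongrightarrow> (Ys, \<theta>s)) \<and>
        is_arg_max (\<lambda>(Y', \<theta>'). SPCP_lagrangian D \<xi> \<delta> x x s Y' \<theta>') (\<lambda>(Y', \<theta>'). 0 \<le> \<theta>') (Ys, \<theta>s)"
      if "norm (D - x) = \<delta>"
    proof -
      obtain r y' t' where r: "strict_mono r" "(\<lambda>k. (Y (r k), \<theta> (r k))) \<longlonglongrightarrow> (y', t')" "0 \<le> t'"
        by (rule multipliers_limit_point)
      \<comment> \<open>Now \<open>|x + s - D| = \<delta>\<close>, so the Lagrangian at \<open>(x, x, s)\<close> does not depend on the multipliers.\<close>
      have "s = 0"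
        using optimal_sparse_part_zero[OF opt] that by simp
      then have "lagrangian x x s Y' \<theta>' = nuclear_norm x" for Y' \<theta>'
        using that g_zero by (simp add: lagrangian_def norm_minus_commute)
      then have "is_arg_max (\<lambda>(Y', \<theta>'). SPCP_lagrangian D \<xi> \<delta> x x s Y' \<theta>') (\<lambda>(Y', \<theta>'). 0 \<le> \<theta>') (y', t')"
        using r(3) by (simp add: lagrangian is_arg_max_def)
      with r show ?thesis
        by blast
    qed
    ultimately show "\<exists>Xs Ss. X \<longlonglongrightarrow> Xs \<and> S \<longlonglongrightarrow> Ss \<and>
           (norm (D - Xs) \<noteq> \<delta> \<longrightarrow>
              (\<exists>\<theta>s\<ge>0. \<exists>Ys. \<theta> \<longlonglongrightarrow> \<theta>s \<and> Y \<longlonglongrightarrow> Ys \<and> SPCP_saddle_point D \<xi> \<delta> Xs Xs Ss Ys \<theta>s)) \<and>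
           (norm (D - Xs) = \<delta> \<longrightarrow>
              (\<exists>Ys \<theta>s. (\<exists>r. strict_mono r \<and> (\<lambda>k. (Y (r k), \<theta> (r k))) \<longlonglongrightarrow> (Ys, \<theta>s)) \<and>
                 is_arg_max (\<lambda>(Y', \<theta>'). SPCP_lagrangian D \<xi> \<delta> Xs Xs Ss Y' \<theta>')
                   (\<lambda>(Y', \<theta>'). 0 \<le> \<theta>') (Ys, \<theta>s)))"
      using lim by blast
  qed
qed

end
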